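(* For every $\varepsilon>0$, every non-superreflexive Banach space $X$, and all $n,k\in\mathbb{N}$ with $k\ge 2$, there exists a bilipschitz embedding of the Laakso graph $L_{n,k}$ (of branching $k$, with its shortest path distance) into $X$ with distortion at most $8+\varepsilon$.
   Context: Laakso graphs of branching $k$: for any integer $k\ge 2$, $L_{1,k}$ is the graph consisting of the $k+4$ vertices $\{s,t,s_1,t_1\}\cup\{v_i\}_{i=1}^k$ joined by the following $2k+2$ edges: $(s,s_1)$, $(t_1,t)$, and, for all $i\in\{1,\dots,k\}$, $(s_1,v_i)$ and $(v_i,t_1)$. For any integer $n\ge 2$, if $L_{n-1,k}$ is defined, $L_{n,k}$ is the graph obtained from $L_{n-1,k}$ by replacing each edge $uv$ of $L_{n-1,k}$ by a copy of $L_{1,k}$ (with the vertices $s,t$ of the copy identified with the endpoints $u,v$). All edges of $L_{n,k}$ have the same weight (length), normalized to $4^{-n}$ so that the distance between the vertices $s$ and $t$ is $1$, and $L_{n,k}$ is endowed with the shortest path distance. Distortion: a map $f:(M,d_M)\to X$ from a metric space to a Banach space is a bilipschitz embedding with distortion at most $D$ if there is $r>0$ such that $r\,d_M(u,v)\le\|f(u)-f(v)\|\le D\,r\,d_M(u,v)$ for all $u,v\in M$. (This notion does not depend on the scaling of the metric.) A Banach space $X$ is superreflexive if every Banach space finitely representable in $X$ is reflexive. *)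

theory Defs
  imports "HOL-Analysis.Analysis" "Graph_Theory.Graph_Theory"
begin

section \<open>Banach space notions\<close>

text \<open>
  \<open>blinfun.prod_left y\<close> is the evaluation functional \<open>f \<mapsto> f y\<close> on the dual space
  \<open>'y \<Rightarrow>\<^sub>L real\<close>, so \<open>blinfun.prod_left\<close> is the canonical embedding of \<open>'y\<close> into its bidual.
\<close>

definition reflexive_space :: "'y::banach itself \<Rightarrow> bool" where
  "reflexive_space _ \<longleftrightarrow>
     surj (blinfun.prod_left :: 'y \<Rightarrow> (('y \<Rightarrow>\<^sub>L real) \<Rightarrow>\<^sub>L real))"

text \<open>
  \<open>Y\<close> is finitely representable in \<open>X\<close>: every finite-dimensional subspace \<open>F\<close> of \<open>Y\<close> is
  \<open>(1 + \<delta>)\<close>-isomorphic to a subspace of \<open>X\<close> (namely \<open>T ` F\<close>), for every \<open>\<delta> > 0\<close>. The norm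
  condition on \<open>T\<close> is imposed on \<open>F\<close> only; taking \<open>T\<close> linear on all of \<open>Y\<close> is no restriction,
  since every linear map on \<open>F\<close> has a (not necessarily bounded) linear extension.
\<close>

definition finitely_representable :: "'y::banach itself \<Rightarrow> 'x::banach itself \<Rightarrow> bool" where
  "finitely_representable _ _ \<longleftrightarrow>
     (\<forall>(F::'y set) (\<delta>::real). subspace F \<and> (\<exists>B. finite B \<and> F = span B) \<and> \<delta> > 0 \<longrightarrow>
        (\<exists>T::'y \<Rightarrow> 'x. linear T \<and>
           (\<forall>y\<in>F. norm y \<le> norm (T y) \<and> norm (T y) \<le> (1 + \<delta>) * norm y)))"

text \<open>
  A Banach space \<open>'x\<close> is superreflexive iff every Banach space \<open>'y\<close> with
  \<open>finitely_representable TYPE('y) TYPE('x)\<close> satisfies \<open>reflexive_space TYPE('y)\<close>. HOL has no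
  quantifier over types inside a formula, so this is not a predicate on \<open>'x\<close> alone. The
  hypothesis that \<open>'x\<close> is \<^emph>\<open>not\<close> superreflexive is an existential statement about \<open>'y\<close>; as a
  premise of a theorem it is stated by a further type variable \<open>'y\<close> together with the two
  premises \<open>finitely_representable TYPE('y) TYPE('x)\<close> and \<open>\<not> reflexive_space TYPE('y)\<close>.
\<close>

definition bilipschitz_embedding_distortion_le ::
    "'m set \<Rightarrow> ('m \<Rightarrow> 'm \<Rightarrow> real) \<Rightarrow> ('m \<Rightarrow> 'x::real_normed_vector) \<Rightarrow> real \<Rightarrow> bool" where
  "bilipschitz_embedding_distortion_le M d f D \<longleftrightarrow>
     (\<exists>r>0. \<forall>u\<in>M. \<forall>v\<in>M.
        r * d u v \<le> norm (f u - f v) \<and> norm (f u - f v) \<le> D * r * d u v)"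

section \<open>Laakso graphs\<close>

text \<open>
  \<open>Inner u v l\<close> is the vertex with role \<open>l\<close> (\<open>s\<^sub>1\<close>, \<open>t\<^sub>1\<close> or \<open>v\<^sub>i\<close>) in the copy of the basic graph
  that replaces the edge \<open>uv\<close>. Edges carry an orientation (from \<open>s\<close> to \<open>t\<close>), which serves
  only to name the inner vertices and is forgotten in the distance below; reversing the
  orientation of a replaced edge gives an isomorphic graph, since the basic graph has an
  automorphism exchanging \<open>s\<close> and \<open>t\<close>.
\<close>

datatype laakso_role = S1 | T1 | V nat

datatype laakso_vertex = Source | Sink | Inner laakso_vertex laakso_vertex laakso_role

definition laakso_cell ::
    "nat \<Rightarrow> laakso_vertex \<Rightarrow> laakso_vertex \<Rightarrow> laakso_vertex pair_pre_digraph" where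
  "laakso_cell k s t =
     (let s1 = Inner s t S1; t1 = Inner s t T1; v = (\<lambda>i. Inner s t (V i)) in
      \<lparr> pverts = {s, t, s1, t1} \<union> v ` {1..k},
        parcs = {(s, s1), (t1, t)} \<union> (\<Union>i\<in>{1..k}. {(s1, v i), (v i, t1)}) \<rparr>)"

definition replace_edges ::
    "nat \<Rightarrow> laakso_vertex pair_pre_digraph \<Rightarrow> laakso_vertex pair_pre_digraph" where
  "replace_edges k G =
     \<lparr> pverts = pverts G \<union> (\<Union>(u, v)\<in>parcs G. pverts (laakso_cell k u v)),
       parcs = (\<Union>(u, v)\<in>parcs G. parcs (laakso_cell k u v)) \<rparr>"

text \<open>
  The recursion starts from a single edge at \<open>n = 0\<close>, so that the graph for \<open>n = 1\<close> is the
  basic graph itself (lemma \<open>laakso_1\<close>).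
\<close>

primrec laakso :: "nat \<Rightarrow> nat \<Rightarrow> laakso_vertex pair_pre_digraph" where
  "laakso 0 k = \<lparr> pverts = {Source, Sink}, parcs = {(Source, Sink)} \<rparr>"
| "laakso (Suc n) k = replace_edges k (laakso n k)"

text \<open>
  Shortest path distance in the underlying undirected graph, each edge having length
  \<open>4\<^sup>-\<^sup>n\<close>. The graph is connected, so the extended real is finite.
\<close>

definition laakso_dist :: "nat \<Rightarrow> nat \<Rightarrow> laakso_vertex \<Rightarrow> laakso_vertex \<Rightarrow> real" where
  "laakso_dist n k u v =
     real_of_ereal
       (wf_digraph.\<mu> (with_proj (mk_symmetric (with_proj (laakso n k)))) (\<lambda>_. 1 / 4 ^ n) u v)"

lemma laakso_1: "laakso 1 k = laakso_cell k Source Sink"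
  by (auto simp: replace_edges_def laakso_cell_def Let_def)

lemma pair_wf_laakso: "pair_wf_digraph (laakso n k)"
proof (induction n)
  case 0
  show ?case by unfold_locales auto
next
  case (Suc n)
  show ?case
    by unfold_locales (fastforce simp: replace_edges_def laakso_cell_def Let_def)+
qed

lemma wf_laakso_sym: "wf_digraph (with_proj (mk_symmetric (with_proj (laakso n k))))"
proof -
  interpret pair_wf_digraph "laakso n k" by (rule pair_wf_laakso)
  interpret S: pair_wf_digraph "mk_symmetric (with_proj (laakso n k))"
    by (rule wellformed_mk_symmetric)
  show ?thesis by (rule S.wf_digraph_axioms)
qed

lemma laakso_dist_eq:
  "laakso_dist n k u v = real_of_ereal
     (INF p\<in>{p. pre_digraph.awalk (with_proj (mk_symmetric (with_proj (laakso n k)))) u p v}.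
        ereal (real (length p) / 4 ^ n))"
  by (simp add: laakso_dist_def wf_digraph.\<mu>_def[OF wf_laakso_sym] wf_digraph.awalk_cost_def[OF wf_laakso_sym]
      sum_list_triv)

primrec laakso_depth :: "laakso_vertex \<Rightarrow> nat" where
  "laakso_depth Source = 0"
| "laakso_depth Sink = 0"
| "laakso_depth (Inner u v l) = Suc (max (laakso_depth u) (laakso_depth v))"

lemma laakso_depth:
  "(\<forall>u\<in>pverts (laakso n k). laakso_depth u \<le> n) \<and>
   (\<forall>(u, v)\<in>parcs (laakso n k). max (laakso_depth u) (laakso_depth v) = n)"
proof (induction n)
  case 0
  show ?case by auto
next
  case (Suc n)
  show ?case
    using Suc by (fastforce simp: replace_edges_def laakso_cell_def Let_def)
qed

text \<open>The inner vertices added at each step are new.\<close>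

lemma laakso_inner_fresh:
  assumes "(u, v) \<in> parcs (laakso n k)"
  shows "Inner u v l \<notin> pverts (laakso n k)"
  using laakso_depth[of n k] assms by fastforce

end

theory Submission
  imports Defs
begin

text \<open>
  Choose \<open>F\<close> in the bidual of the nonreflexive space outside the canonical image, and a bounded
  ultrafilter \<open>U\<close> on the space converging weakly to \<open>F\<close>. The iterated \<open>U\<close>-limit of
  \<open>\<parallel>a\<^sub>1 y\<^sub>1 + \<dots> + a\<^sub>l y\<^sub>l\<parallel>\<close> is a seminorm on coefficient lists that is finitely representable in
  the space, ignores zero coefficients, and does not increase when two adjacent opposite
  coefficients are cancelled. Since the canonical image is closed, alternating blocks of averages
  keep a norm bounded away from zero; this replaces the equal-signs-additive bases of Brunel and
  Sucheston.

  A vertex of the Laakso graph goes to a signed indicator function on \<open>2\<^sup>k\<close> pairs of consecutive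
  blocks, each pair consisting of a positive and a negative block divided into \<open>4\<^sup>n\<close> cells. Along
  an oriented edge one cell is filled in every block, so all edges have the norm of the same
  alternating list. The order of filling in the two middle quarters depends on the branch \<open>i\<close>, on
  the pair \<open>S \<subseteq> {1..k}\<close> and on the sign of the block. For two branches, a quarter of
  the pairs is such that cancellation reduces the difference of two vertices to an alternating
  list whose entries are at least half their distance; passing from \<open>2\<^sup>k\<close> pairs to a
  quarter of them costs a factor 4, whence the distortion 8.
\<close>

section \<open>Limits along ultrafilters\<close>

text \<open>Zorn's lemma for the reversed order gives a minimal proper filter below
  \<open>F\<close>; chains have proper infima because a finite infimum in a chain is attained. By
  minimality, the meet of \<open>U\<close> with the principal filter of a property is
  \<open>bot\<close> or \<open>U\<close>.\<close>

lemma ultrafilter_refinement: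
  fixes F :: "'a filter"
  assumes "F \<noteq> bot"
  shows "\<exists>U\<le>F. U \<noteq> bot \<and> (\<forall>P. eventually P U \<or> eventually (\<lambda>x. \<not> P x) U)"
proof -
  let ?A = "{G. G \<le> F \<and> G \<noteq> bot}"
  have "\<exists>m\<in>?A. \<forall>a\<in>?A. a \<le> m \<longrightarrow> a = m"
  proof (rule predicate_Zorn[where P = "\<lambda>x y. y \<le> x"])
    show "partial_order_on ?A (relation_of (\<lambda>x y. y \<le> x) ?A)"
      by (rule partial_order_on_relation_ofI) auto
    fix C assume "C \<in> Chains (relation_of (\<lambda>x y. y \<le> x) ?A)"
    then have C: "C \<subseteq> ?A" "\<And>x y. x \<in> C \<Longrightarrow> y \<in> C \<Longrightarrow> x \<le> y \<or> y \<le> x"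
      unfolding Chains_def relation_of_def by blast+
    show "\<exists>u\<in>?A. \<forall>a\<in>C. u \<le> a"
    proof (cases "C = {}")
      case False
      have *: "Inf X \<noteq> bot" if "finite X" "X \<subseteq> C" for X
      proof -
        have "X = {} \<or> Inf X \<in> X"
          using that
        proof (induction X)
          case (insert x X)
          then have "Inf X \<in> X" if "X \<noteq> {}"
            using that by auto
          with insert have "inf x (Inf X) \<in> {x, Inf X}" if "X \<noteq> {}"
            using C(2)[of x "Inf X"] that
            by (metis inf.absorb1 inf.absorb2 insertCI insert_subset subsetD)
          then show ?case using \<open>X \<noteq> {} \<Longrightarrow> Inf X \<in> X\<close> by (cases "X = {}") auto
        qed auto
        then show ?thesis
          using C that by (cases "X = {}") (auto simp: trivial_limit_def)
      qed
      have "Inf C \<noteq> bot"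
        by (rule Inf_filter_not_bot) (rule *)
      moreover have "Inf C \<le> F"
      proof -
        obtain G where "G \<in> C" using False by blast
        then show ?thesis using C(1) Inf_lower[of G C] by auto
      qed
      ultimately show ?thesis
        by (blast intro: Inf_lower)
    qed (use assms in auto)
  qed
  then obtain U where U: "U \<le> F" "U \<noteq> bot" and min: "\<And>G. G \<le> U \<Longrightarrow> G \<noteq> bot \<Longrightarrow> G = U"
    by (auto dest: order_trans)
  have "eventually P U \<or> eventually (\<lambda>x. \<not> P x) U" for P
  proof (cases "inf U (principal {x. P x}) = bot")
    case True
    then show ?thesis
      by (auto simp: trivial_limit_def eventually_inf_principal)
  next
    case False
    then have "inf U (principal {x. P x}) = U"
      by (intro min) auto
    then have "U \<le> principal {x. P x}"
      by (metis inf.cobounded2)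
    then show ?thesis
      by (simp add: le_principal)
  qed
  with U show ?thesis by blast
qed

text \<open>Compactness yields a cluster point of the image filter. For an ultrafilter it is a
  limit, since failing to be eventually in a neighbourhood means being eventually outside
  it.\<close>

lemma ultrafilter_tendsto_compact:
  assumes U: "U \<noteq> bot" "\<And>P. eventually P U \<or> eventually (\<lambda>x. \<not> P x) U"
    and "compact K" and "eventually (\<lambda>x. g x \<in> K) U"
  shows "\<exists>l\<in>K. (g \<longlongrightarrow> l) U"
proof -
  have "filtermap g U \<noteq> bot" "eventually (\<lambda>y. y \<in> K) (filtermap g U)"
    using assms(4) U(1) by (simp_all add: eventually_filtermap filtermap_bot_iff)
  then obtain l where l: "l \<in> K" "inf (nhds l) (filtermap g U) \<noteq> bot"
    using \<open>compact K\<close> unfolding compact_filter by blast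
  have "eventually (\<lambda>x. g x \<in> S) U" if S: "open S" "l \<in> S" for S
  proof (rule ccontr)
    assume "\<not> ?thesis"
    then have "eventually (\<lambda>y. y \<notin> S) (filtermap g U)"
      using U(2)[of "\<lambda>x. g x \<in> S"] by (simp add: eventually_filtermap)
    moreover have "eventually (\<lambda>y. y \<in> S) (nhds l)"
      using S by (rule eventually_nhds_in_open)
    ultimately have "eventually (\<lambda>_. False) (inf (nhds l) (filtermap g U))"
      unfolding eventually_inf by (metis (mono_tags, lifting))
    with l(2) show False by (simp add: trivial_limit_def)
  qed
  then show ?thesis using l(1) by (auto simp: tendsto_def)
qed

section \<open>Iterated norms\<close>

locale bounded_ultrafilter =
  fixes U :: "'y::real_normed_vector filter" and K :: real
  assumes nonbot: "U \<noteq> bot"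
    and ultra: "eventually P U \<or> eventually (\<lambda>y. \<not> P y) U"
    and bounded: "eventually (\<lambda>y. norm y \<le> K) U"
begin

text \<open>The limit for the first coefficient is the outermost one, so each vector is chosen after
  the earlier ones. The offset \<open>u\<close> collects the vectors already chosen.\<close>

primrec iter_norm :: "real list \<Rightarrow> 'y \<Rightarrow> real" where
  "iter_norm [] u = norm u"
| "iter_norm (a # as) u = Lim U (\<lambda>y. iter_norm as (u + a *\<^sub>R y))"

declare iter_norm.simps(2) [simp del]

text \<open>\<open>Lim\<close> is meaningful only where a limit exists. The bounds place the inner
  values in a compact interval, so existence and bounds go together through the induction on the
  list.\<close>

lemma iter_norm_step:
  assumes *: "\<And>u. 0 \<le> iter_norm as u \<and> iter_norm as u \<le> norm u + K * (\<Sum>a\<leftarrow>as. \<bar>a\<bar>)"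
  shows "((\<lambda>y. iter_norm as (u + a *\<^sub>R y)) \<longlongrightarrow> iter_norm (a # as) u) U"
    and "0 \<le> iter_norm (a # as) u \<and>
      iter_norm (a # as) u \<le> norm u + K * (\<Sum>a\<leftarrow>a # as. \<bar>a\<bar>)"
proof -
  have "eventually (\<lambda>y. iter_norm as (u + a *\<^sub>R y) \<in> {0..norm u + K * (\<Sum>a\<leftarrow>a # as. \<bar>a\<bar>)}) U"
    using bounded
  proof eventually_elim
    case (elim y)
    have "norm (u + a *\<^sub>R y) \<le> norm u + \<bar>a\<bar> * K"
      by (metis abs_ge_zero elim mult_left_mono norm_scaleR norm_triangle_le add_left_mono)
    then show ?case
      using *[of "u + a *\<^sub>R y"] by (simp add: algebra_simps)
  qed
  from ultrafilter_tendsto_compact[OF nonbot ultra compact_Icc this]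
  obtain l where l: "l \<in> {0..norm u + K * (\<Sum>a\<leftarrow>a # as. \<bar>a\<bar>)}"
    "((\<lambda>y. iter_norm as (u + a *\<^sub>R y)) \<longlongrightarrow> l) U"
    by blast
  have "iter_norm (a # as) u = l"
    using l(2) nonbot by (simp add: tendsto_Lim iter_norm.simps)
  with l show "((\<lambda>y. iter_norm as (u + a *\<^sub>R y)) \<longlongrightarrow> iter_norm (a # as) u) U"
    and "0 \<le> iter_norm (a # as) u \<and>
      iter_norm (a # as) u \<le> norm u + K * (\<Sum>a\<leftarrow>a # as. \<bar>a\<bar>)"
    by simp_all
qed

lemma iter_norm_bounds: "0 \<le> iter_norm as u \<and> iter_norm as u \<le> norm u + K * (\<Sum>a\<leftarrow>as. \<bar>a\<bar>)"
proof (induction as arbitrary: u)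
  case (Cons a as)
  show ?case by (rule iter_norm_step(2)) (rule Cons.IH)
qed simp

lemma iter_norm_tendsto: "((\<lambda>y. iter_norm as (u + a *\<^sub>R y)) \<longlongrightarrow> iter_norm (a # as) u) U"
  by (rule iter_norm_step(1)) (rule iter_norm_bounds)

lemma iter_norm_nonneg: "0 \<le> iter_norm as u"
  using iter_norm_bounds by simp

lemma iter_norm_prefix_mono:
  assumes "\<And>v. iter_norm as v \<le> iter_norm bs v"
  shows "iter_norm (xs @ as) u \<le> iter_norm (xs @ bs) u"
proof (induction xs arbitrary: u)
  case (Cons x xs)
  then show ?case
    by (simp, intro tendsto_le[OF nonbot iter_norm_tendsto iter_norm_tendsto]) simp
qed (use assms in simp)

lemma iter_norm_Cons_0 [simp]: "iter_norm (0 # as) u = iter_norm as u"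
  using nonbot by (simp add: iter_norm.simps tendsto_Lim)

lemma iter_norm_append_cong:
  assumes "\<And>v. iter_norm as v = iter_norm bs v"
  shows "iter_norm (xs @ as) u = iter_norm (xs @ bs) u"
  using iter_norm_prefix_mono[of as bs xs u] iter_norm_prefix_mono[of bs as xs u] assms
  by (simp add: order_antisym)

lemma iter_norm_filter: "iter_norm (filter (\<lambda>a. a \<noteq> 0) as) u = iter_norm as u"
proof (induction as arbitrary: u)
  case (Cons a as)
  then show ?case
    using iter_norm_append_cong[of "filter (\<lambda>a. a \<noteq> 0) as" as "[a]"] by simp
qed simp

lemma iter_norm_zeros [simp]: "iter_norm (replicate n 0 @ as) u = iter_norm as u"
  by (induction n) auto

text \<open>Triangle inequality and homogeneity jointly in coefficients and offset. The same vector
  \<open>y\<close> serves in all three limits, so the inequality passes from norms to iterated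
  norms.\<close>

lemma iter_norm_linear_le:
  assumes "length as = length bs"
  shows "iter_norm (map2 (\<lambda>a b. s * a + t * b) as bs) (s *\<^sub>R u + t *\<^sub>R v)
         \<le> \<bar>s\<bar> * iter_norm as u + \<bar>t\<bar> * iter_norm bs v"
  using assms
proof (induction as bs arbitrary: u v rule: list_induct2)
  case Nil
  then show ?case
    by simp (metis norm_scaleR norm_triangle_ineq)
next
  case (Cons a as b bs)
  show ?case
  proof (simp, rule tendsto_le[OF nonbot tendsto_add[OF tendsto_mult_left[OF iter_norm_tendsto]
      tendsto_mult_left[OF iter_norm_tendsto]] iter_norm_tendsto], intro always_eventually allI)
    fix y
    show "iter_norm (map2 (\<lambda>a b. s * a + t * b) as bs) (s *\<^sub>R u + t *\<^sub>R v + (s * a + t * b) *\<^sub>R y)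
        \<le> \<bar>s\<bar> * iter_norm as (u + a *\<^sub>R y) + \<bar>t\<bar> * iter_norm bs (v + b *\<^sub>R y)"
      using Cons.IH[of "u + a *\<^sub>R y" "v + b *\<^sub>R y"] by (simp add: algebra_simps)
  qed
qed

lemma map2_same: "map2 f as as = map (\<lambda>a. f a a) as"
  by (induction as) auto

lemma iter_norm_scale_le: "iter_norm (map ((*) c) as) (c *\<^sub>R u) \<le> \<bar>c\<bar> * iter_norm as u"
  using iter_norm_linear_le[of as as c 0 u u] by (simp add: map2_same)

lemma iter_norm_scale: "iter_norm (map ((*) c) as) (c *\<^sub>R u) = \<bar>c\<bar> * iter_norm as u"
proof (cases "c = 0")
  case True
  then show ?thesis
    using iter_norm_scale_le[of c as u] iter_norm_nonneg[of "map ((*) c) as" "c *\<^sub>R u"] by simp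
next
  case False
  have "iter_norm as u \<le> \<bar>1 / c\<bar> * iter_norm (map ((*) c) as) (c *\<^sub>R u)"
    using iter_norm_scale_le[of "1 / c" "map ((*) c) as" "c *\<^sub>R u"] False by (simp add: o_def)
  then show ?thesis
    using iter_norm_scale_le[of c as u] False by (simp add: field_simps)
qed

lemma iter_norm_diff_le: "iter_norm as u \<le> iter_norm as v + norm (u - v)"
proof -
  have "map2 (\<lambda>a b. 1 * a + 1 * b) as (replicate (length as) 0) = as"
    by (induction as) auto
  then show ?thesis
    using iter_norm_linear_le[of as "replicate (length as) 0" 1 1 v "u - v"]
      iter_norm_zeros[of "length as" "[]"] by simp
qed

lemma iter_norm_append_le: "iter_norm (as @ bs) 0 \<le> iter_norm as 0 + iter_norm bs 0"
proof -
  have 1: "map2 (\<lambda>a b. 1 * a + 1 * b) (as @ replicate (length bs) 0)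
      (replicate (length as) 0 @ bs) = as @ (bs :: real list)"
  proof -
    have "map2 (\<lambda>a b. 1 * a + 1 * b) as (replicate (length as) 0) = as"
      by (induction as) auto
    moreover have "map2 (\<lambda>a b. 1 * a + 1 * b) (replicate (length bs) 0) bs = bs"
      by (induction bs) auto
    ultimately show ?thesis by (simp add: zip_append)
  qed
  have 2: "iter_norm (as @ replicate (length bs) 0) 0 = iter_norm as 0"
    using iter_norm_append_cong[of "replicate (length bs) 0" "[]" as]
      iter_norm_zeros[of "length bs" "[]"] by simp
  show ?thesis
    using iter_norm_linear_le[of "as @ replicate (length bs) 0" "replicate (length as) 0 @ bs" 1 1 0 0]
    unfolding 1 by (simp add: 2)
qed

text \<open>Inserting a zero after or before \<open>x\<close> does not change the norm, and the
  left-hand list is the convex combination of these two lists.\<close>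

lemma iter_norm_split_le:
  assumes "0 \<le> s" "s \<le> 1"
  shows "iter_norm (s * x # (1 - s) * x # as) u \<le> iter_norm (x # as) u"
proof -
  have "map2 (\<lambda>a b. s * a + (1 - s) * b) (x # 0 # as) (0 # x # as) = s * x # (1 - s) * x # as"
    by (simp add: map2_same algebra_simps)
  moreover have "iter_norm (x # 0 # as) u = iter_norm (x # as) u"
    using iter_norm_append_cong[of "0 # as" as "[x]"] by simp
  ultimately show ?thesis
    using iter_norm_linear_le[of "x # 0 # as" "0 # x # as" s "1 - s" u u] assms
    by (simp add: algebra_simps flip: scaleR_add_left)
qed

lemma iter_norm_average_le:
  "iter_norm (replicate (Suc q) (x / real (Suc q)) @ as) u \<le> iter_norm (x # as) u"
proof (induction q arbitrary: x u)
  case (Suc q)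
  \<comment> \<open>The first slot takes its final share \<open>s\<close>; the remainder
    \<open>x'\<close> is spread over the other \<open>Suc q\<close> slots by induction.\<close>
  define s where "s = 1 / real (Suc (Suc q))"
  define x' where "x' = (1 - s) * x"
  have s: "0 \<le> s" "s \<le> 1" by (auto simp: s_def)
  have e: "x / real (Suc (Suc q)) = s * x" "s * x = x' / real (Suc q)"
  proof -
    have "1 - s = real (Suc q) / real (Suc (Suc q))"
      by (simp add: s_def field_simps)
    then show "s * x = x' / real (Suc q)"
      unfolding x'_def s_def by simp
  qed (simp add: s_def)
  have "iter_norm ([s * x] @ (replicate (Suc q) (x' / real (Suc q)) @ as)) u
      \<le> iter_norm ([s * x] @ (x' # as)) u"
    by (intro iter_norm_prefix_mono Suc)
  also have "\<dots> \<le> iter_norm (x # as) u"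
    using iter_norm_split_le[OF s, of x as u] by (simp add: x'_def)
  finally show ?case unfolding e(1) by (simp add: e(2))
qed simp

lemma iter_norm_average_all_le:
  assumes "q > 0"
  shows "iter_norm (replicate (m * q) (x / real q)) u \<le> iter_norm (replicate m x) u"
proof (induction m arbitrary: u)
  case (Suc m)
  have "iter_norm (replicate (Suc m * q) (x / real q)) u
      = iter_norm (replicate q (x / real q) @ replicate (m * q) (x / real q)) u"
    by (simp add: replicate_add)
  also have "\<dots> \<le> iter_norm (replicate q (x / real q) @ replicate m x) u"
    by (intro iter_norm_prefix_mono Suc)
  also have "\<dots> \<le> iter_norm (x # replicate m x) u"
    using iter_norm_average_le[of "q - 1"] assms by simp
  finally show ?case by simp
qed simp

text \<open>After inserting a zero, the left-hand list is the mean of two spreads of \<open>[c, - c]\<close>.\<close>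

lemma iter_norm_halve_le:
  "iter_norm (c / 2 # - c / 2 # as) u \<le> iter_norm (c # - c # as) u"
proof -
  have 1: "map2 (\<lambda>a b. 1 / 2 * a + 1 / 2 * b) (c # - c # 0 # as) (0 # c # - c # as)
      = c / 2 # 0 # - c / 2 # as"
    by (simp add: map2_same)
  have 2: "iter_norm (c / 2 # 0 # - c / 2 # as) u = iter_norm (c / 2 # - c / 2 # as) u"
    using iter_norm_append_cong[of "0 # - c / 2 # as" "- c / 2 # as" "[c / 2]"] by simp
  have 3: "iter_norm (c # - c # 0 # as) u = iter_norm (c # - c # as) u"
    using iter_norm_append_cong[of "0 # as" "as" "[c, - c]"] by simp
  show ?thesis
    using iter_norm_linear_le[of "c # - c # 0 # as" "0 # c # - c # as" "1/2" "1/2" u u]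
    unfolding 1 2 3 by (simp add: 2[simplified] flip: scaleR_add_left)
qed

lemma iter_norm_Cons_ge: "iter_norm as u - \<bar>c\<bar> * K \<le> iter_norm (c # as) u"
proof (rule tendsto_lowerbound[OF iter_norm_tendsto _ nonbot])
  show "\<forall>\<^sub>F y in U. iter_norm as u - \<bar>c\<bar> * K \<le> iter_norm as (u + c *\<^sub>R y)"
    using bounded
  proof eventually_elim
    case (elim y)
    then have "norm (c *\<^sub>R y) \<le> \<bar>c\<bar> * K" by (simp add: mult_left_mono)
    then show ?case using iter_norm_diff_le[of as u "u + c *\<^sub>R y"] by simp
  qed
qed

text \<open>Halving replaces \<open>c\<close> by \<open>c / 2 ^ p\<close> without increasing the
  norm, and removing two coefficients of that size costs at most
  \<open>2 * (\<bar>c / 2 ^ p\<bar> * K)\<close>, which vanishes as \<open>p\<close> grows.\<close>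

lemma iter_norm_cancel_le: "iter_norm as u \<le> iter_norm (c # - c # as) u"
proof -
  have half: "iter_norm (c / 2 ^ p # - (c / 2 ^ p) # as) u \<le> iter_norm (c # - c # as) u" for p
  proof (induction p)
    case (Suc p)
    then show ?case
      using iter_norm_halve_le[of "c / 2 ^ p" as u] by (simp add: field_simps)
  qed simp
  have "iter_norm as u - 2 * (\<bar>c / 2 ^ p\<bar> * K) \<le> iter_norm (c # - c # as) u" for p
  proof -
    define e where "e = c / 2 ^ p"
    show ?thesis
      using half[of p] iter_norm_Cons_ge[of as u "- e"] iter_norm_Cons_ge[of "- e # as" u e]
      unfolding e_def[symmetric] by simp
  qed
  moreover have "(\<lambda>p. iter_norm as u - 2 * (\<bar>c\<bar> * (1 / 2) ^ p * K)) \<longlonglongrightarrow> iter_norm as u - 2 * (\<bar>c\<bar> * 0 * K)"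
    by (intro tendsto_intros LIMSEQ_realpow_zero) auto
  ultimately show ?thesis
    by (intro LIMSEQ_le_const2) (auto simp: power_divide abs_divide intro!: exI[of _ 0])
qed

end

section \<open>Nonreflexive spaces\<close>

text \<open>
  Moving \<open>y\<close> towards a near-maximiser of \<open>\<Sum>f. (F f - f y) * f\<close> on the ball decreases the sum
  of squared errors, which avoids the Hahn-Banach theorem.
\<close>

lemma bidual_finite_approximation:
  fixes F :: "('y::real_normed_vector \<Rightarrow>\<^sub>L real) \<Rightarrow>\<^sub>L real"
  assumes "finite \<Phi>" and "\<epsilon> > 0"
  shows "\<exists>y. norm y \<le> norm F \<and> (\<Sum>f\<in>\<Phi>. (F f - f y)\<^sup>2) < \<epsilon>"
proof (rule ccontr)
  define err where "err y = (\<Sum>f\<in>\<Phi>. (F f - f y)\<^sup>2)" for y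
  define C where "C = (\<Sum>f\<in>\<Phi>. (norm f * (2 * norm F))\<^sup>2)"
  define \<delta> where "\<delta> = (INF y\<in>cball 0 (norm F). err y)"
  assume "\<not> ?thesis"
  then have ge: "\<epsilon> \<le> err y" if "y \<in> cball 0 (norm F)" for y
    using that by (auto simp: err_def not_less)
  have ne: "cball (0::'y) (norm F) \<noteq> {}" by simp
  have bdd: "bdd_below (err ` cball 0 (norm F))"
    using ge by (intro bdd_belowI2)
  have \<delta>: "\<epsilon> \<le> \<delta>" "\<And>y. y \<in> cball 0 (norm F) \<Longrightarrow> \<delta> \<le> err y"
    unfolding \<delta>_def using ge by (auto intro!: cINF_greatest[OF ne] cINF_lower[OF bdd])
  have C: "0 \<le> C" unfolding C_def by (intro sum_nonneg) auto
  \<comment> \<open>The step \<open>t\<close> is small enough that the quadratic term, at most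
    \<open>t * \<delta> / 2\<close>, leaves a decrease of \<open>t * \<delta>\<close> out of the
    linear gain \<open>3 / 2 * t * \<delta>\<close>.\<close>
  define t where "t = min 1 (\<delta> / (2 * C + 1))"
  have t: "0 < t" "t \<le> 1" "t * C \<le> \<delta> / 2"
  proof -
    show "0 < t" "t \<le> 1" using \<delta>(1) assms(2) C by (auto simp: t_def)
    have "t * C \<le> \<delta> / (2 * C + 1) * C"
      using C by (intro mult_right_mono) (auto simp: t_def)
    also have "\<dots> \<le> \<delta> / 2"
      using C \<delta>(1) assms(2) by (simp add: field_simps)
    finally show "t * C \<le> \<delta> / 2" .
  qed
  have "\<delta> < \<delta> + t * \<delta> / 2" using t \<delta>(1) assms(2) by simp
  then obtain y where y: "y \<in> cball 0 (norm F)" "err y < \<delta> + t * \<delta> / 2"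
    unfolding \<delta>_def using cINF_less_iff[OF ne bdd] by blast
  define g where "g = (\<Sum>f\<in>\<Phi>. (F f - f y) *\<^sub>R f)"
  have g: "blinfun_apply g v = (\<Sum>f\<in>\<Phi>. (F f - f y) * f v)" for v
    by (simp add: g_def blinfun.sum_left blinfun.scaleR_left)
  have "F g = (\<Sum>f\<in>\<Phi>. (F f - f y) * F f)"
    by (simp add: g_def blinfun.sum_right blinfun.scaleR_right)
  then have Fg: "F g - g y = err y"
    by (simp add: g err_def power2_eq_square right_diff_distrib flip: sum_subtractf)
  \<comment> \<open>Otherwise \<open>g\<close> would be bounded by \<open>F g - \<delta> / 4\<close>
    on the ball of radius \<open>norm F\<close>, making \<open>norm F * norm g\<close> smaller than
    \<open>F g\<close>.\<close>
  have "\<exists>z. norm z \<le> norm F \<and> F g - \<delta> / 4 < g z"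
  proof (rule ccontr)
    assume "\<not> ?thesis"
    then have le: "g z \<le> F g - \<delta> / 4" if "norm z \<le> norm F" for z
      using that by force
    have nonneg: "0 \<le> F g - \<delta> / 4" using le[of 0] by simp
    have "F \<noteq> 0"
      using nonneg \<delta>(1) assms(2) by auto
    then have pos: "norm F > 0" by simp
    have "norm g \<le> (F g - \<delta> / 4) / norm F"
    proof (rule norm_blinfun_bound)
      fix x :: 'y
      show "norm (g x) \<le> (F g - \<delta> / 4) / norm F * norm x"
      proof (cases "x = 0")
        case False
        define z where "z = (norm F / norm x) *\<^sub>R x"
        have "norm z \<le> norm F" using False by (simp add: z_def)
        then have "\<bar>g z\<bar> \<le> F g - \<delta> / 4"
          using le[of z] le[of "- z"] by (simp add: blinfun.minus_right)
        moreover have "\<bar>g z\<bar> = norm F / norm x * \<bar>g x\<bar>"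
          using pos by (simp add: z_def blinfun.scaleR_right abs_mult)
        ultimately show ?thesis
          using False pos by (simp add: field_simps)
      qed simp
    qed (use nonneg in simp)
    then have "norm F * norm g \<le> F g - \<delta> / 4"
      using pos by (simp add: field_simps)
    moreover have "F g \<le> norm F * norm g"
      using norm_blinfun[of F g] by simp
    ultimately show False using \<delta>(1) assms(2) by simp
  qed
  then obtain z where z: "norm z \<le> norm F" "F g - \<delta> / 4 < g z" by blast
  define w where "w = y + t *\<^sub>R (z - y)"
  have w: "w \<in> cball 0 (norm F)"
  proof -
    have "w = (1 - t) *\<^sub>R y + t *\<^sub>R z" by (simp add: w_def algebra_simps)
    then show ?thesis
      using convex_cball[of "0::'y" "norm F"] y(1) z(1) t unfolding convex_alt by auto
  qed
  have "err w = (\<Sum>f\<in>\<Phi>. (F f - f y)\<^sup>2 - 2 * t * ((F f - f y) * (f z - f y)) + t\<^sup>2 * (f z - f y)\<^sup>2)"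
    unfolding err_def w_def
    by (intro sum.cong refl) (simp add: blinfun.add_right blinfun.scaleR_right blinfun.diff_right
        power2_eq_square algebra_simps)
  also have "\<dots> = err y - 2 * t * (g z - g y) + t\<^sup>2 * (\<Sum>f\<in>\<Phi>. (blinfun_apply f z - f y)\<^sup>2)"
    by (simp add: sum.distrib sum_subtractf err_def g algebra_simps sum_distrib_left)
  also have "\<dots> \<le> err y - 2 * t * (3 / 4 * \<delta>) + t\<^sup>2 * C"
  proof -
    have "3 / 4 * \<delta> \<le> g z - g y"
      using z(2) Fg \<delta>(2)[OF y(1)] by simp
    then have "2 * t * (3 / 4 * \<delta>) \<le> 2 * t * (g z - g y)"
      using t by (intro mult_left_mono) auto
    moreover have "(\<Sum>f\<in>\<Phi>. (blinfun_apply f z - f y)\<^sup>2) \<le> C"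
      unfolding C_def
    proof (intro sum_mono abs_le_square_iff[THEN iffD1])
      fix f :: "'y \<Rightarrow>\<^sub>L real"
      have "\<bar>f z - f y\<bar> \<le> norm f * norm (z - y)"
        using norm_blinfun[of f "z - y"] by (simp add: blinfun.diff_right)
      also have "\<dots> \<le> norm f * (2 * norm F)"
        using norm_triangle_ineq4[of z y] z(1) y(1) by (intro mult_left_mono) auto
      finally show "\<bar>f z - f y\<bar> \<le> \<bar>norm f * (2 * norm F)\<bar>" by simp
    qed
    then have "t\<^sup>2 * (\<Sum>f\<in>\<Phi>. (blinfun_apply f z - f y)\<^sup>2) \<le> t\<^sup>2 * C" by (intro mult_left_mono) auto
    ultimately show ?thesis by simp
  qed
  also have "t\<^sup>2 * C \<le> t * (\<delta> / 2)"
    using t by (simp add: power2_eq_square)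
  finally have "err w \<le> err y - t * \<delta>" by (simp add: algebra_simps)
  moreover have "0 < t * \<delta>" using t(1) \<delta>(1) assms(2) by simp
  ultimately have "err w < \<delta>" using y(2) by linarith
  with \<delta>(2)[OF w] show False by simp
qed

locale bidual_ultrafilter = bounded_ultrafilter U K
  for U :: "'y::banach filter" and K +
  fixes F :: "('y \<Rightarrow>\<^sub>L real) \<Rightarrow>\<^sub>L real"
  assumes weak_tendsto: "((\<lambda>y. blinfun_apply f y) \<longlongrightarrow> F f) U"
    and not_canonical: "F \<notin> range blinfun.prod_left"

text \<open>The sets \<open>A (f, e)\<close> are the bounded traces on the space of weak
  neighbourhoods of \<open>F\<close>. Their finite intersections are nonempty by
  \<open>bidual_finite_approximation\<close>, so they generate a proper filter, which an ultrafilter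
  refines.\<close>

lemma ex_bidual_ultrafilter:
  assumes "\<not> reflexive_space TYPE('y::banach)"
  shows "\<exists>(U :: 'y filter) K F. bidual_ultrafilter U K F"
proof -
  obtain F :: "('y \<Rightarrow>\<^sub>L real) \<Rightarrow>\<^sub>L real" where F: "F \<notin> range blinfun.prod_left"
    using assms unfolding reflexive_space_def by blast
  define A where "A = (\<lambda>(f :: 'y \<Rightarrow>\<^sub>L real, e). {y. norm y \<le> norm F \<and> \<bar>blinfun_apply f y - F f\<bar> < e})"
  let ?I = "UNIV \<times> {0<..} :: (('y \<Rightarrow>\<^sub>L real) \<times> real) set"
  have "(INF p\<in>?I. principal (A p)) \<noteq> bot"
  proof (rule INF_filter_not_bot)
    fix X assume X: "X \<subseteq> ?I" "finite X"
    \<comment> \<open>The inserted 1 keeps the minimum defined for empty \<open>X\<close>. A sum of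
      squares below \<open>e\<^sup>2\<close> makes every single error smaller than
      \<open>e\<close>.\<close>
    define e where "e = Min (insert 1 (snd ` X))"
    have e: "0 < e" "\<And>f e'. (f, e') \<in> X \<Longrightarrow> e \<le> e'"
    proof -
      show "0 < e" unfolding e_def using X by (subst Min_gr_iff) auto
      show "e \<le> e'" if "(f, e') \<in> X" for f e'
        unfolding e_def using X that by (intro Min_le) force+
    qed
    obtain y where y: "norm y \<le> norm F" "(\<Sum>f\<in>fst ` X. (F f - f y)\<^sup>2) < e\<^sup>2"
      using bidual_finite_approximation[of "fst ` X" "e\<^sup>2" F] X(2) e(1) by auto
    have "y \<in> A p" if "p \<in> X" for p
    proof -
      obtain f e' where p: "p = (f, e')" by fastforce
      have "f \<in> fst ` X" using that p by force
      then have "(F f - f y)\<^sup>2 \<le> (\<Sum>f\<in>fst ` X. (F f - f y)\<^sup>2)"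
        using X(2) by (intro member_le_sum) auto
      then have "(F f - f y)\<^sup>2 < e\<^sup>2" using y(2) by simp
      then have "\<bar>F f - f y\<bar> < e"
        using e(1) power2_less_imp_less[of "\<bar>F f - f y\<bar>" e] by simp
      then show ?thesis using e(2)[of f e'] that y(1) by (auto simp: A_def p)
    qed
    then have "y \<in> (\<Inter>p\<in>X. A p)" by blast
    then show "(INF p\<in>X. principal (A p)) \<noteq> bot"
      unfolding INF_principal_finite[OF X(2)] by (auto simp: principal_eq_bot_iff)
  qed
  from ultrafilter_refinement[OF this] obtain U where
    U: "U \<le> (INF p\<in>?I. principal (A p))" "U \<noteq> bot"
    "\<And>P. eventually P U \<or> eventually (\<lambda>x. \<not> P x) U" by blast
  have ev: "eventually (\<lambda>y. norm y \<le> norm F \<and> \<bar>f y - F f\<bar> < e) U" if "e > 0" for f :: "'y \<Rightarrow>\<^sub>L real" and e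
  proof -
    have "U \<le> principal (A (f, e))"
      using U(1) that by (auto intro: order_trans INF_lower)
    then show ?thesis by (simp add: le_principal A_def)
  qed
  have "bidual_ultrafilter U (norm F) F"
  proof
    show "eventually (\<lambda>y. norm y \<le> norm F) U"
      using ev[of 1 0] by (auto elim: eventually_mono)
    show "((\<lambda>y. blinfun_apply f y) \<longlongrightarrow> F f) U" for f
      unfolding tendsto_iff dist_real_def by (intro allI impI eventually_mono[OF ev[of _ f]]) auto
  qed (use U F in auto)
  then show ?thesis by blast
qed

section \<open>Lower bounds from a functional outside the canonical image\<close>

context bidual_ultrafilter begin

text \<open>Under \<open>f\<close>, each chosen vector contributes \<open>F f\<close> in the limit,
  so only the sum of the coefficients remains.\<close>

lemma functional_le_iter_norm:
  "\<bar>blinfun_apply f u + sum_list as * F f\<bar> \<le> norm f * iter_norm as u"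
proof (induction as arbitrary: u)
  case Nil
  then show ?case using norm_blinfun[of f u] by simp
next
  case (Cons a as)
  have "((\<lambda>y. \<bar>f u + a * f y + sum_list as * F f\<bar>) \<longlongrightarrow> \<bar>f u + a * F f + sum_list as * F f\<bar>) U"
    by (intro tendsto_intros weak_tendsto)
  then have "\<bar>f u + a * F f + sum_list as * F f\<bar> \<le> norm f * iter_norm (a # as) u"
  proof (rule tendsto_le[OF nonbot, rotated])
    show "((\<lambda>y. norm f * iter_norm as (u + a *\<^sub>R y)) \<longlongrightarrow> norm f * iter_norm (a # as) u) U"
      by (intro tendsto_intros iter_norm_tendsto)
    show "\<forall>\<^sub>F y in U. \<bar>f u + a * f y + sum_list as * F f\<bar> \<le> norm f * iter_norm as (u + a *\<^sub>R y)"
    proof (intro always_eventually allI)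
      fix y
      show "\<bar>f u + a * f y + sum_list as * F f\<bar> \<le> norm f * iter_norm as (u + a *\<^sub>R y)"
        using Cons[of "u + a *\<^sub>R y"] by (simp add: blinfun.add_right blinfun.scaleR_right)
    qed
  qed
  then show ?case by (simp add: algebra_simps)
qed

lemma iter_norm_append_lower:
  assumes "\<And>v. c \<le> iter_norm bs v"
  shows "c \<le> iter_norm (as @ bs) u"
proof (induction as arbitrary: u)
  case (Cons a as)
  then show ?case
    using tendsto_lowerbound[OF iter_norm_tendsto _ nonbot] by simp
qed (use assms in simp)

text \<open>The distance from \<open>u\<close> to an average of \<open>q\<close> successive vectors
  along \<open>U\<close>: a substitute, inside the space, for the distance from \<open>u\<close> to
  \<open>F\<close> in the bidual.\<close>

definition avg_dist :: "nat \<Rightarrow> 'y \<Rightarrow> real" where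
  "avg_dist q u = iter_norm (replicate q (- 1 / real q)) u"

lemma avg_dist_triangle: "norm (u - v) \<le> avg_dist q u + avg_dist q v"
proof -
  let ?a = "replicate q (- 1 / real q)"
  have "map2 (\<lambda>a b. 1 * a + (- 1) * b) ?a ?a = replicate q 0"
    by (simp add: map2_same map_replicate_const)
  then show ?thesis
    using iter_norm_linear_le[of ?a ?a 1 "- 1" u v] iter_norm_zeros[of q "[]"]
    by (simp add: avg_dist_def)
qed

lemma avg_dist_mult_le: "q > 0 \<Longrightarrow> p > 0 \<Longrightarrow> avg_dist (p * q) u \<le> avg_dist p u"
  using iter_norm_average_all_le[of q p "- 1 / real p" u] by (simp add: avg_dist_def)

text \<open>
  Points with \<open>avg_dist\<close> tending to 0 would form a Cauchy sequence whose limit represents \<open>F\<close>.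
\<close>

lemma ex_avg_dist_lower_bound: "\<exists>c>0. \<forall>q>0. \<forall>u. c \<le> avg_dist q u"
proof (rule ccontr)
  assume "\<not> ?thesis"
  then have "\<exists>q u. q > 0 \<and> avg_dist q u < 1 / real (Suc n)" for n
    by (meson not_le of_nat_0_less_iff zero_less_Suc zero_less_divide_1_iff)
  then obtain q u where q: "\<And>n. q n > 0" and u: "\<And>n. avg_dist (q n) (u n) < 1 / real (Suc n)"
    by metis
  \<comment> \<open>Multiplying the length of the average does not increase \<open>avg_dist\<close>,
    so both points are compared with averages of the common length \<open>q m * q n\<close>.\<close>
  have dist: "norm (u m - u n) \<le> 1 / real (Suc m) + 1 / real (Suc n)" for m n
    using avg_dist_triangle[of "u m" "u n" "q m * q n"] u[of m] u[of n]
      avg_dist_mult_le[OF q[of n] q[of m], of "u m"] avg_dist_mult_le[OF q[of m] q[of n], of "u n"]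
    by (simp add: mult.commute)
  have "Cauchy u"
  proof (rule metric_CauchyI)
    fix e :: real assume "e > 0"
    then obtain N where N: "inverse (real (Suc N)) < e / 2"
      using reals_Archimedean[of "e / 2"] by auto
    show "\<exists>M. \<forall>m\<ge>M. \<forall>n\<ge>M. dist (u m) (u n) < e"
    proof (intro exI allI impI)
      fix m n assume "N \<le> m" "N \<le> n"
      then have "1 / real (Suc m) \<le> inverse (real (Suc N))" "1 / real (Suc n) \<le> inverse (real (Suc N))"
        by (simp_all add: field_simps)
      then show "dist (u m) (u n) < e"
        using dist[of m n] N by (simp add: dist_norm)
    qed
  qed
  then obtain x where x: "u \<longlonglongrightarrow> x"
    using Cauchy_convergent convergent_def by blast
  have "F f = f x" for f
  proof -
    have "(\<lambda>n. \<bar>f (u n) - F f\<bar>) \<longlonglongrightarrow> \<bar>f x - F f\<bar>"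
      by (intro tendsto_intros x)
    moreover have "(\<lambda>n. norm f * (1 / real (Suc n))) \<longlonglongrightarrow> norm f * 0"
      using LIMSEQ_inverse_real_of_nat by (intro tendsto_intros) (simp add: inverse_eq_divide)
    moreover have "\<bar>f (u n) - F f\<bar> \<le> norm f * (1 / real (Suc n))" for n
    proof -
      have "\<bar>f (u n) - F f\<bar> \<le> norm f * avg_dist (q n) (u n)"
        using functional_le_iter_norm[of f "u n" "replicate (q n) (- 1 / real (q n))"] q[of n]
        by (simp add: avg_dist_def sum_list_replicate)
      also have "\<dots> \<le> norm f * (1 / real (Suc n))"
        using u[of n] by (intro mult_left_mono) auto
      finally show ?thesis .
    qed
    ultimately have "\<bar>f x - F f\<bar> \<le> norm f * 0"
      by (intro LIMSEQ_le) auto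
    then show ?thesis by simp
  qed
  then have "F = blinfun.prod_left x"
    by (intro blinfun_eqI) simp
  with not_canonical show False by blast
qed

end

section \<open>Cancellation in coefficient lists\<close>

text \<open>The reduced form, after all cancellations, of a list of entries \<open>c\<close> and
  \<open>- c\<close> with total \<open>s * c\<close>.\<close>

definition signed_replicate :: "int \<Rightarrow> real \<Rightarrow> real list" where
  "signed_replicate s c = replicate (nat \<bar>s\<bar>) (if s \<ge> 0 then c else - c)"

context bounded_ultrafilter begin

text \<open>Quantifying over the tail and the offset makes the relation compatible with
  concatenation on both sides.\<close>

definition dominated :: "real list \<Rightarrow> real list \<Rightarrow> bool" where
  "dominated as bs \<longleftrightarrow> (\<forall>zs u. iter_norm (as @ zs) u \<le> iter_norm (bs @ zs) u)"

lemma dominated_iter_norm: "dominated as bs \<Longrightarrow> iter_norm as u \<le> iter_norm bs u"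
  unfolding dominated_def by (metis append_Nil2)

lemma dominated_refl [simp]: "dominated as as"
  by (simp add: dominated_def)

lemma dominated_trans [trans]: "dominated as bs \<Longrightarrow> dominated bs cs \<Longrightarrow> dominated as cs"
  unfolding dominated_def by (meson order_trans)

lemma dominated_append:
  assumes "dominated as bs" "dominated as' bs'"
  shows "dominated (as @ as') (bs @ bs')"
  unfolding dominated_def
proof (intro allI)
  fix zs u
  have "iter_norm (as @ as' @ zs) u \<le> iter_norm (as @ bs' @ zs) u"
    using assms(2) by (intro iter_norm_prefix_mono) (simp add: dominated_def)
  also have "\<dots> \<le> iter_norm (bs @ bs' @ zs) u"
    using assms(1) by (simp add: dominated_def)
  finally show "iter_norm ((as @ as') @ zs) u \<le> iter_norm ((bs @ bs') @ zs) u" by simp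
qed

lemma dominated_concat_map:
  assumes "\<And>x. x \<in> set xs \<Longrightarrow> dominated (f x) (g x)"
  shows "dominated (concat (map f xs)) (concat (map g xs))"
  using assms by (induction xs) (auto intro: dominated_append)

lemma dominated_zero: "dominated as (0 # as)"
  by (simp add: dominated_def)

lemma dominated_cancel: "dominated as (c # - c # as)"
  by (simp add: dominated_def iter_norm_cancel_le)

text \<open>If \<open>z\<close> and \<open>s\<close> have opposite signs, the new head cancels
  against the first entry of the reduced tail; otherwise it is a zero or lengthens the run. Iterated
  from the right, this reduces a list of signs to its sum.\<close>

lemma dominated_signed_replicate_Cons:
  assumes "z \<in> {-1, 0, 1}"
  shows "dominated (signed_replicate (z + s) c) (of_int z * c # signed_replicate s c)"
proof -
  consider "z = 0" | "z = 1" "s \<ge> 0" | "z = 1" "s < 0" | "z = -1" "s > 0" | "z = -1" "s \<le> 0"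
    using assms by force
  then show ?thesis
  proof cases
    case 2
    then have "nat \<bar>z + s\<bar> = Suc (nat \<bar>s\<bar>)" by simp
    with 2 show ?thesis by (simp add: signed_replicate_def)
  next
    case 3
    then have "nat \<bar>s\<bar> = Suc (nat \<bar>z + s\<bar>)" by simp
    with 3 have "signed_replicate s c = - c # signed_replicate (z + s) c"
      by (auto simp: signed_replicate_def)
    with 3 show ?thesis by (simp add: dominated_cancel)
  next
    case 4
    then have "nat \<bar>s\<bar> = Suc (nat \<bar>z + s\<bar>)" by simp
    with 4 have "signed_replicate s c = c # signed_replicate (z + s) c"
      by (auto simp: signed_replicate_def)
    with 4 show ?thesis using dominated_cancel[of _ "- c"] by simp
  next
    case 5
    then have "nat \<bar>z + s\<bar> = Suc (nat \<bar>s\<bar>)" by simp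
    with 5 show ?thesis by (auto simp: signed_replicate_def)
  qed (simp add: dominated_zero)
qed

lemma dominated_signed_replicate:
  assumes "set zs \<subseteq> {-1, 0, 1 :: int}"
  shows "dominated (signed_replicate (sum_list zs) c) (map (\<lambda>z. of_int z * c) zs)"
  using assms
proof (induction zs)
  case Nil
  then show ?case by (simp add: signed_replicate_def)
next
  case (Cons z zs)
  have "dominated (signed_replicate (z + sum_list zs) c)
      ([of_int z * c] @ signed_replicate (sum_list zs) c)"
    using dominated_signed_replicate_Cons[of z] Cons.prems by simp
  also have "dominated \<dots> ([of_int z * c] @ map (\<lambda>z. of_int z * c) zs)"
    using Cons by (intro dominated_append) auto
  finally show ?case by simp
qed

text \<open>This brings finitely many iterated norms back to norms of actual vectors. The outermost
  limit gives one \<open>y\<close> that is good within \<open>\<epsilon> / 2\<close> for all lists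
  at once; \<open>y\<close> then enters the offsets, and the induction spends the other half of the
  error.\<close>

lemma ex_realization:
  assumes "finite D" "\<And>as u. (as, u) \<in> D \<Longrightarrow> length as = L" "\<epsilon> > 0"
  shows "\<exists>ys. length ys = L \<and>
    (\<forall>(as, u)\<in>D. \<bar>norm (u + (\<Sum>(a, y)\<leftarrow>zip as ys. a *\<^sub>R y)) - iter_norm as u\<bar> < \<epsilon>)"
  using assms
proof (induction L arbitrary: D \<epsilon>)
  case 0
  then show ?case by (intro exI[of _ "[]"]) (force simp: case_prod_unfold)
next
  case (Suc L)
  let ?step = "\<lambda>y. \<lambda>(as, u). (tl as, u + hd as *\<^sub>R y)"
  have "\<forall>\<^sub>F y in U. \<bar>iter_norm (tl (fst p)) (snd p + hd (fst p) *\<^sub>R y) - iter_norm (fst p) (snd p)\<bar> < \<epsilon> / 2"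
    if "p \<in> D" for p
  proof -
    obtain as' u where p': "p = (as', u)" by (cases p)
    then have "length as' = Suc L"
      using Suc.prems(2)[of as' u] that by simp
    then obtain a as where "as' = a # as" by (cases as') auto
    with p' have p: "p = (a # as, u)" by simp
    show ?thesis
      using tendstoD[OF iter_norm_tendsto[of as u a], of "\<epsilon> / 2"] Suc.prems(3)
      by (simp add: p dist_real_def)
  qed
  then have "\<forall>\<^sub>F y in U. \<forall>p\<in>D. \<bar>iter_norm (tl (fst p)) (snd p + hd (fst p) *\<^sub>R y) - iter_norm (fst p) (snd p)\<bar> < \<epsilon> / 2"
    using Suc.prems(1) by (simp add: eventually_ball_finite)
  then obtain y where y: "\<And>as u. (as, u) \<in> D \<Longrightarrow>
      \<bar>iter_norm (tl as) (u + hd as *\<^sub>R y) - iter_norm as u\<bar> < \<epsilon> / 2"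
    using eventually_happens'[OF nonbot] by fastforce
  have "\<exists>ys. length ys = L \<and>
    (\<forall>(as, u)\<in>?step y ` D. \<bar>norm (u + (\<Sum>(a, y)\<leftarrow>zip as ys. a *\<^sub>R y)) - iter_norm as u\<bar> < \<epsilon> / 2)"
    using Suc.prems by (intro Suc.IH) (auto dest: Suc.prems(2))
  then obtain ys where ys1: "length ys = L" and
    ys2: "\<forall>(as, u)\<in>?step y ` D. \<bar>norm (u + (\<Sum>(a, y)\<leftarrow>zip as ys. a *\<^sub>R y)) - iter_norm as u\<bar> < \<epsilon> / 2"
    by blast
  have ys3: "\<bar>norm (u + hd as *\<^sub>R y + (\<Sum>(a, y)\<leftarrow>zip (tl as) ys. a *\<^sub>R y)) - iter_norm (tl as) (u + hd as *\<^sub>R y)\<bar> < \<epsilon> / 2"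
    if "(as, u) \<in> D" for as u
    using bspec[OF ys2 imageI[OF that]] by simp
  have "\<bar>norm (u + (\<Sum>(a, y)\<leftarrow>zip as (y # ys). a *\<^sub>R y)) - iter_norm as u\<bar> < \<epsilon>" if m: "(as, u) \<in> D" for as u
  proof -
    obtain a as' where as: "as = a # as'"
      using Suc.prems(2)[OF m] by (cases as) auto
    have "\<bar>iter_norm as' (u + a *\<^sub>R y) - iter_norm as u\<bar> < \<epsilon> / 2"
      using y[OF m] by (simp only: as list.sel)
    moreover have "\<bar>norm (u + (\<Sum>(a, y)\<leftarrow>zip as (y # ys). a *\<^sub>R y)) - iter_norm as' (u + a *\<^sub>R y)\<bar> < \<epsilon> / 2"
      using ys3[OF m] by (simp add: as add.assoc)
    ultimately show ?thesis by linarith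
  qed
  then show ?case
    using ys1 by (intro exI[of _ "y # ys"]) auto
qed

text \<open>Here \<open>m\<close> counts the pairs of blocks, and each block spreads a coefficient 1
  or -1 over \<open>q\<close> entries.\<close>

definition alternating_norm :: "nat \<Rightarrow> nat \<Rightarrow> real" where
  "alternating_norm q m =
     iter_norm (concat (replicate m (replicate q (1 / real q) @ replicate q (- 1 / real q)))) 0"

lemma alternating_norm_mult_le: "alternating_norm q (j * m) \<le> real j * alternating_norm q m"
proof (induction j)
  case (Suc j)
  have "alternating_norm q (Suc j * m) \<le> alternating_norm q m + alternating_norm q (j * m)"
    using iter_norm_append_le by (simp add: alternating_norm_def replicate_add)
  then show ?case using Suc by (simp add: algebra_simps)
qed (simp add: alternating_norm_def)

end

text \<open>The last negative block is an \<open>avg_dist\<close> whose offset comes from the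
  earlier entries, so the infimum over \<open>q\<close> is positive. A near-optimal \<open>q\<close>
  serves the upper estimate, while \<open>N\<close> still bounds the norms with the longer blocks
  \<open>\<alpha> * q\<close> of the lower estimate.\<close>

lemma (in bidual_ultrafilter) ex_alternating_norm_near_inf:
  assumes "m > 0" "\<eta> > 0"
  shows "\<exists>N>0. (\<forall>q>0. N \<le> alternating_norm q m) \<and> (\<exists>q>0. alternating_norm q m \<le> (1 + \<eta>) * N)"
proof -
  obtain c where c: "c > 0" "\<And>q u. q > 0 \<Longrightarrow> c \<le> avg_dist q u"
    using ex_avg_dist_lower_bound by blast
  have ge: "c \<le> alternating_norm q m" if "q > 0" for q
  proof -
    obtain m' where m: "m = Suc m'" using assms(1) gr0_implies_Suc by blast
    have "c \<le> iter_norm ((concat (replicate m' (replicate q (1 / real q) @ replicate q (- 1 / real q)))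
        @ replicate q (1 / real q)) @ replicate q (- 1 / real q)) 0"
      using c(2)[OF that] by (intro iter_norm_append_lower) (simp add: avg_dist_def)
    moreover have "replicate (Suc m') x = replicate m' x @ [x]" for x :: "real list"
      by (simp add: replicate_append_same)
    ultimately show ?thesis
      unfolding alternating_norm_def m by simp
  qed
  define N where "N = (INF q\<in>{0<..}. alternating_norm q m)"
  have bdd: "bdd_below ((\<lambda>q. alternating_norm q m) ` {0<..})"
    using ge by (intro bdd_belowI2) auto
  have "c \<le> N" unfolding N_def using ge by (intro cINF_greatest) auto
  then have N: "N > 0" using c(1) by simp
  then have "N < (1 + \<eta>) * N" using assms(2) by simp
  then obtain q where "q > 0" "alternating_norm q m < (1 + \<eta>) * N"
    unfolding N_def using cINF_less_iff[OF _ bdd] by auto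
  moreover have "\<forall>q>0. N \<le> alternating_norm q m"
    unfolding N_def using bdd by (auto intro: cINF_lower)
  ultimately show ?thesis using N by (intro exI[of _ N]) auto
qed

section \<open>Coefficient lists indexed by pairs of blocks\<close>

lemma concat_map_if_eq:
  assumes "distinct xs" "w \<in> set xs"
  shows "concat (map (\<lambda>x. if x = w then r else []) xs) = r"
proof -
  have "concat (map (\<lambda>x. if x = w then r else []) xs) = []" if "w \<notin> set xs" for xs
    using that by (induction xs) auto
  then show ?thesis
    using assms by (induction xs) auto
qed

lemma concat_map_if_mem:
  assumes "distinct xs" "G \<subseteq> set xs"
  shows "concat (map (\<lambda>x. if x \<in> G then r else []) xs) = concat (replicate (card G) r)"
proof -
  have "concat (map (\<lambda>x. if x \<in> G then r else []) xs) = concat (map (\<lambda>x. r) (filter (\<lambda>x. x \<in> G) xs))"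
    by (induction xs) auto
  also have "\<dots> = concat (replicate (length (filter (\<lambda>x. x \<in> G) xs)) r)"
    by (simp add: map_replicate_const)
  also have "length (filter (\<lambda>x. x \<in> G) xs) = card G"
    using assms distinct_length_filter[of xs "\<lambda>x. x \<in> G"] by (simp add: Int_absorb2 Int_commute Collect_mem_eq)
  finally show ?thesis .
qed

text \<open>
  An index \<open>(S, \<sigma>, t)\<close> is the cell \<open>t\<close> of the block of sign \<open>\<sigma>\<close> in the pair \<open>S\<close>; each cell is
  repeated \<open>q\<close> times.
\<close>

definition index_block :: "nat \<Rightarrow> 's \<Rightarrow> bool \<Rightarrow> nat \<Rightarrow> nat \<Rightarrow> ('s \<times> bool \<times> nat) list" where
  "index_block q S \<sigma> a b = concat (map (\<lambda>t. replicate q (S, \<sigma>, t)) [a..<b])"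

definition index_list :: "nat \<Rightarrow> 's list \<Rightarrow> nat \<Rightarrow> ('s \<times> bool \<times> nat) list" where
  "index_list q Ss n = concat (map (\<lambda>S. index_block q S True 0 n @ index_block q S False 0 n) Ss)"

definition signed :: "('s \<Rightarrow> bool \<Rightarrow> nat \<Rightarrow> int) \<Rightarrow> 's \<times> bool \<times> nat \<Rightarrow> int" where
  "signed z = (\<lambda>(S, \<sigma>, t). if \<sigma> then z S \<sigma> t else - z S \<sigma> t)"

lemma signed_simps [simp]:
  "signed z (S, True, t) = z S True t" "signed z (S, False, t) = - z S False t"
  by (simp_all add: signed_def)

lemma index_block_split: "a \<le> b \<Longrightarrow> b \<le> c \<Longrightarrow>
    index_block q S \<sigma> a c = index_block q S \<sigma> a b @ index_block q S \<sigma> b c"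
  unfolding index_block_def by (metis concat_append map_append upt_add_eq_append le_Suc_ex)

lemma sum_list_signed_index_block:
  "sum_list (map (signed z) (index_block q S \<sigma> a b)) =
     (if \<sigma> then 1 else -1) * int q * (\<Sum>t=a..<b. z S \<sigma> t)"
proof (cases "a \<le> b")
  case True
  then show ?thesis
    by (induction b rule: dec_induct)
      (auto simp: index_block_def sum_list_replicate signed_def algebra_simps map_replicate)
qed (simp add: index_block_def)

context bounded_ultrafilter begin

text \<open>Every segment dominates the reduced list of its sum. For \<open>S\<close> in
  \<open>G\<close> the positive block after \<open>\<tau>\<close> and the negative block before
  \<open>\<tau>\<close> both have \<open>z\<close>-sum \<open>\<delta> - \<alpha>\<close> and are
  adjacent, so with their opposite signs they reduce to nothing.\<close>

lemma iter_norm_profile_ge: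
  fixes z :: "'s \<Rightarrow> bool \<Rightarrow> nat \<Rightarrow> int"
  assumes Ss: "distinct Ss" "G \<subseteq> set Ss"
    and z: "\<And>S \<sigma> t. z S \<sigma> t \<in> {-1, 0, 1}"
    and pre: "\<And>S. S \<in> G \<Longrightarrow> \<tau> S True \<le> n \<and> (\<Sum>t=0..<\<tau> S True. z S True t) = int \<alpha>"
    and suf: "\<And>S. S \<in> G \<Longrightarrow> \<tau> S False \<le> n \<and> (\<Sum>t=\<tau> S False..<n. z S False t) = int \<alpha>"
    and total: "\<And>S \<sigma>. S \<in> set Ss \<Longrightarrow> (\<Sum>t=0..<n. z S \<sigma> t) = \<delta>"
    and "\<alpha> > 0" "q > 0"
  shows "real \<alpha> * alternating_norm (\<alpha> * q) (card G)
    \<le> iter_norm (map (\<lambda>i. of_int (signed z i) * (1 / real q)) (index_list q Ss n)) 0"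
proof -
  define v where "v is = map (\<lambda>i. of_int (signed z i) * (1 / real q)) is" for "is"
  have v_append: "v (xs @ ys) = v xs @ v ys" for xs ys by (simp add: v_def)
  have v: "dominated (signed_replicate (sum_list (map (signed z) is)) (1 / real q)) (v is)" for "is"
  proof -
    have "signed z i \<in> {-1, 0, 1}" for i
      using z[of "fst i" "fst (snd i)" "snd (snd i)"] by (auto simp: signed_def case_prod_unfold)
    then have "set (map (signed z) is) \<subseteq> {-1, 0, 1}" by auto
    from dominated_signed_replicate[OF this, of "1 / real q"] show ?thesis by (simp add: v_def o_def)
  qed
  define r where "r = replicate (\<alpha> * q) (1 / real q) @ replicate (\<alpha> * q) (- (1 / real q))"
  have S: "dominated (if S \<in> G then r else []) (v (index_block q S True 0 n @ index_block q S False 0 n))"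
    if "S \<in> set Ss" for S
  proof (cases "S \<in> G")
    case False
    have "sum_list (map (signed z) (index_block q S True 0 n @ index_block q S False 0 n)) = 0"
      using total[OF that] by (simp add: sum_list_signed_index_block)
    with v[of "index_block q S True 0 n @ index_block q S False 0 n"] False
    show ?thesis by (simp add: signed_replicate_def)
  next
    case True
    let ?A = "index_block q S True 0 (\<tau> S True)" and ?B = "index_block q S True (\<tau> S True) n"
      and ?C = "index_block q S False 0 (\<tau> S False)" and ?D = "index_block q S False (\<tau> S False) n"
    have "(\<Sum>t=0..<n. z S True t) = (\<Sum>t=0..<\<tau> S True. z S True t) + (\<Sum>t=\<tau> S True..<n. z S True t)"
      "(\<Sum>t=0..<n. z S False t) = (\<Sum>t=0..<\<tau> S False. z S False t) + (\<Sum>t=\<tau> S False..<n. z S False t)"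
      using pre[OF True] suf[OF True]
        sum.atLeastLessThan_concat[of 0 "\<tau> S True" n "z S True"]
        sum.atLeastLessThan_concat[of 0 "\<tau> S False" n "z S False"] by simp_all
    then have "sum_list (map (signed z) (?B @ ?C)) = 0"
      using total[OF that] pre[OF True] suf[OF True]
      by (simp add: sum_list_signed_index_block)
    moreover have "sum_list (map (signed z) ?A) = int (\<alpha> * q)"
      "sum_list (map (signed z) ?D) = - int (\<alpha> * q)"
      using pre[OF True] suf[OF True] by (simp_all add: sum_list_signed_index_block)
    moreover have "\<not> int \<alpha> * int q \<le> 0"
      using assms(7,8) by (simp add: mult_le_0_iff)
    ultimately have "dominated (replicate (\<alpha> * q) (1 / real q)) (v ?A)"
      "dominated [] (v (?B @ ?C))" "dominated (replicate (\<alpha> * q) (- (1 / real q))) (v ?D)"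
      using v[of ?A] v[of "?B @ ?C"] v[of ?D] assms(7,8)
      by (simp_all add: signed_replicate_def nat_mult_distrib abs_mult del: map_append)
    then have "dominated r (v ?A @ v (?B @ ?C) @ v ?D)"
      unfolding r_def by (metis append_Nil dominated_append)
    moreover have "index_block q S True 0 n = ?A @ ?B" "index_block q S False 0 n = ?C @ ?D"
      using pre[OF True] suf[OF True] by (simp_all add: index_block_split)
    ultimately show ?thesis using True by (simp add: v_append)
  qed
  have "dominated (concat (replicate (card G) r)) (v (index_list q Ss n))"
  proof -
    have "v (index_list q Ss n) =
        concat (map (\<lambda>S. v (index_block q S True 0 n @ index_block q S False 0 n)) Ss)"
      by (simp add: v_def index_list_def map_concat o_def)
    then show ?thesis
      unfolding concat_map_if_mem[OF Ss, symmetric] by (auto intro: dominated_concat_map S)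
  qed
  then have "iter_norm (concat (replicate (card G) r)) 0 \<le> iter_norm (v (index_list q Ss n)) 0"
    by (rule dominated_iter_norm)
  \<comment> \<open>Runs of \<open>\<alpha> * q\<close> entries \<open>1 / q\<close> are
    \<open>\<alpha>\<close> times averages over that many entries; hence the first argument of
    \<open>alternating_norm\<close>.\<close>
  also have "concat (replicate (card G) r) = map ((*) (real \<alpha>)) (concat (replicate (card G)
      (replicate (\<alpha> * q) (1 / real (\<alpha> * q)) @ replicate (\<alpha> * q) (- 1 / real (\<alpha> * q)))))"
    using \<open>\<alpha> > 0\<close> by (simp add: map_concat r_def)
  finally show ?thesis
    using iter_norm_scale[of "real \<alpha>" _ 0] by (simp add: alternating_norm_def v_def)
qed

text \<open>Dropping the zeros forgets the positions \<open>w\<close> of the filled cells. This is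
  what gives all edges the same norm.\<close>

lemma iter_norm_profile_indicator:
  fixes z :: "'s \<Rightarrow> bool \<Rightarrow> nat \<Rightarrow> int"
  assumes "\<And>S \<sigma>. S \<in> set Ss \<Longrightarrow> w S \<sigma> < n"
    and "\<And>S \<sigma> t. S \<in> set Ss \<Longrightarrow> t < n \<Longrightarrow> z S \<sigma> t = (if t = w S \<sigma> then 1 else 0)"
    and "q > 0"
  shows "iter_norm (map (\<lambda>i. of_int (signed z i) * (1 / real q)) (index_list q Ss n)) 0
    = alternating_norm q (length Ss)"
proof -
  let ?v = "\<lambda>i. of_int (signed z i) * (1 / real q)"
  have block: "filter (\<lambda>a. a \<noteq> 0) (map ?v (index_block q S \<sigma> 0 n))
      = replicate q ((if \<sigma> then 1 else - 1) / real q)" if "S \<in> set Ss" for S \<sigma>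
  proof -
    have "filter (\<lambda>a. a \<noteq> 0) (map ?v (index_block q S \<sigma> 0 n))
      = concat (map (\<lambda>t. filter (\<lambda>a. a \<noteq> 0) (replicate q (?v (S, \<sigma>, t)))) [0..<n])"
      by (simp add: index_block_def map_concat filter_concat o_def)
    also have "\<dots> = concat (map (\<lambda>t. if t = w S \<sigma> then replicate q ((if \<sigma> then 1 else - 1) / real q) else []) [0..<n])"
      using assms(2)[OF that] \<open>q > 0\<close>
      by (intro arg_cong[of _ _ concat] map_cong refl) (auto simp: signed_def filter_replicate)
    also have "\<dots> = replicate q ((if \<sigma> then 1 else - 1) / real q)"
      using assms(1)[OF that] by (intro concat_map_if_eq) auto
    finally show ?thesis .
  qed
  have "filter (\<lambda>a. a \<noteq> 0) (map ?v (index_list q Ss n))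
    = concat (map (\<lambda>S. replicate q (1 / real q) @ replicate q (- 1 / real q)) Ss)"
    unfolding index_list_def map_concat filter_concat map_map o_def map_append filter_append
    by (intro arg_cong[of _ _ concat] map_cong refl) (simp only: block if_True if_False)
  then show ?thesis
    using iter_norm_filter[of "map ?v (index_list q Ss n)" 0]
    by (simp add: alternating_norm_def map_replicate_const)
qed

end

section \<open>Vertices and distances of Laakso graphs\<close>

abbreviation subarcs :: "nat \<Rightarrow> laakso_vertex \<times> laakso_vertex \<Rightarrow> (laakso_vertex \<times> laakso_vertex) set" where
  "subarcs k e \<equiv> parcs (laakso_cell k (fst e) (snd e))"

primrec expand :: "nat \<Rightarrow> nat \<Rightarrow> laakso_vertex \<times> laakso_vertex \<Rightarrow> (laakso_vertex \<times> laakso_vertex) set" where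
  "expand k 0 e = {e}"
| "expand k (Suc m) e = (\<Union>e'\<in>subarcs k e. expand k m e')"

text \<open>\<open>expand\<close> subdivides the initial edge and recurses into the parts, whereas
  \<open>laakso\<close> subdivides every edge of the previous graph; this identity reconciles the
  two orders.\<close>

lemma expand_Suc_bottom: "expand k (Suc m) e = (\<Union>e'\<in>expand k m e. subarcs k e')"
proof (induction m arbitrary: e)
  case (Suc m)
  have "expand k (Suc (Suc m)) e = (\<Union>e'\<in>subarcs k e. expand k (Suc m) e')"
    by simp
  also have "\<dots> = (\<Union>e'\<in>subarcs k e. \<Union>e''\<in>expand k m e'. subarcs k e'')"
    using Suc by (intro SUP_cong) auto
  finally show ?case by auto
qed simp

lemma parcs_laakso: "parcs (laakso n k) = expand k n (Source, Sink)"
proof (induction n)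
  case (Suc n)
  have "parcs (laakso (Suc n) k) = (\<Union>e\<in>parcs (laakso n k). subarcs k e)"
    by (simp add: replace_edges_def case_prod_unfold)
  then show ?case using Suc by (simp only: expand_Suc_bottom)
qed simp

definition endpoints :: "(laakso_vertex \<times> laakso_vertex) set \<Rightarrow> laakso_vertex set" where
  "endpoints A = fst ` A \<union> snd ` A"

lemma endpoints_UN: "endpoints (\<Union>i\<in>I. A i) = (\<Union>i\<in>I. endpoints (A i))"
  by (auto simp: endpoints_def)

lemma pverts_laakso_cell: "pverts (laakso_cell k u v) = endpoints (parcs (laakso_cell k u v))"
  unfolding endpoints_def laakso_cell_def Let_def by (force simp: image_iff)

lemma pverts_laakso: "pverts (laakso n k) = endpoints (parcs (laakso n k))"
proof (induction n)
  case (Suc n)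
  have "pverts (laakso n k) \<subseteq> (\<Union>e\<in>parcs (laakso n k). pverts (laakso_cell k (fst e) (snd e)))"
    unfolding Suc by (fastforce simp: endpoints_def laakso_cell_def Let_def)
  then have "pverts (laakso (Suc n) k) = (\<Union>e\<in>parcs (laakso n k). pverts (laakso_cell k (fst e) (snd e)))"
    by (auto simp: replace_edges_def case_prod_unfold)
  also have "\<dots> = endpoints (\<Union>e\<in>parcs (laakso n k). subarcs k e)"
    by (simp add: endpoints_UN pverts_laakso_cell)
  also have "(\<Union>e\<in>parcs (laakso n k). subarcs k e) = parcs (laakso (Suc n) k)"
    by (simp add: replace_edges_def case_prod_unfold)
  finally show ?case .
qed (auto simp: endpoints_def)

lemma finite_expand: "finite (expand k n e)"
proof (induction n arbitrary: e)
  case (Suc n)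
  have "finite (subarcs k e)" by (simp add: laakso_cell_def Let_def)
  then show ?case using Suc by simp
qed simp

lemma finite_pverts_laakso: "finite (pverts (laakso n k))"
  by (simp add: pverts_laakso parcs_laakso endpoints_def finite_expand)

section \<open>Walks as powers of the symmetric edge relation\<close>

lemma awalk_imp_relpow:
  assumes "pre_digraph.awalk (with_proj (mk_symmetric (with_proj G))) u p v"
  shows "(u, v) \<in> (parcs G \<union> (parcs G)\<inverse>) ^^ length p"
proof -
  have "(u, v) \<in> (parcs G \<union> (parcs G)\<inverse>) ^^ length p"
    if "set p \<subseteq> parcs G \<union> (parcs G)\<inverse>" "pre_digraph.cas (with_proj (mk_symmetric (with_proj G))) u p v"
    using that
  proof (induction p arbitrary: u)
    case (Cons e p)
    then have "(u, snd e) \<in> parcs G \<union> (parcs G)\<inverse>" "(snd e, v) \<in> (parcs G \<union> (parcs G)\<inverse>) ^^ length p"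
      by (cases e; simp add: pre_digraph.cas.simps)+
    from relpow_Suc_I2[OF this] show ?case by simp
  qed (simp add: pre_digraph.cas.simps)
  moreover have "parcs (mk_symmetric (with_proj G)) = parcs G \<union> (parcs G)\<inverse>"
    by (auto simp: parcs_mk_symmetric)
  ultimately show ?thesis
    using assms by (simp add: pre_digraph.awalk_def)
qed

lemma relpow_imp_awalk:
  assumes "(u, v) \<in> (parcs G \<union> (parcs G)\<inverse>) ^^ m" "u \<in> pverts G"
  shows "\<exists>p. pre_digraph.awalk (with_proj (mk_symmetric (with_proj G))) u p v \<and> length p = m"
proof -
  have "\<exists>p. set p \<subseteq> parcs G \<union> (parcs G)\<inverse> \<and>
      pre_digraph.cas (with_proj (mk_symmetric (with_proj G))) u p v \<and> length p = m"
    using assms(1)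
  proof (induction m arbitrary: u)
    case (Suc m)
    then obtain w where w: "(u, w) \<in> parcs G \<union> (parcs G)\<inverse>"
      "(w, v) \<in> (parcs G \<union> (parcs G)\<inverse>) ^^ m"
      by (meson relpow_Suc_D2)
    obtain p where "set p \<subseteq> parcs G \<union> (parcs G)\<inverse>"
      "pre_digraph.cas (with_proj (mk_symmetric (with_proj G))) w p v" "length p = m"
      using Suc.IH[OF w(2)] by blast
    then show ?case
      using w(1) by (intro exI[of _ "(u, w) # p"]) (auto simp: pre_digraph.cas.simps)
  qed (auto simp: pre_digraph.cas.simps)
  then obtain p where p: "set p \<subseteq> parcs G \<union> (parcs G)\<inverse>"
      "pre_digraph.cas (with_proj (mk_symmetric (with_proj G))) u p v" "length p = m"
    by blast
  moreover have "parcs (mk_symmetric (with_proj G)) = parcs G \<union> (parcs G)\<inverse>"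
    by (auto simp: parcs_mk_symmetric)
  ultimately show ?thesis
    using assms(2) by (intro exI[of _ p]) (simp add: pre_digraph.awalk_def)
qed

definition walk_rel :: "nat \<Rightarrow> nat \<Rightarrow> (laakso_vertex \<times> laakso_vertex) set" where
  "walk_rel n k = parcs (laakso n k) \<union> (parcs (laakso n k))\<inverse>"

lemma laakso_dist_bounds:
  assumes "(u, v) \<in> walk_rel n k ^^ m" "u \<in> pverts (laakso n k)"
    and "\<And>l. (u, v) \<in> walk_rel n k ^^ l \<Longrightarrow> x \<le> real l"
  shows "laakso_dist n k u v \<le> real m / 4 ^ n" "x / 4 ^ n \<le> laakso_dist n k u v"
proof -
  let ?W = "{p. pre_digraph.awalk (with_proj (mk_symmetric (with_proj (laakso n k)))) u p v}"
  let ?I = "INF p\<in>?W. ereal (real (length p) / 4 ^ n)"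
  obtain p where p: "p \<in> ?W" "length p = m"
    using relpow_imp_awalk[OF assms(1)[unfolded walk_rel_def] assms(2)] by blast
  have le: "?I \<le> ereal (real m / 4 ^ n)"
    using p by (auto intro!: INF_lower2[OF p(1)])
  have "x \<le> real (length p)" if "p \<in> ?W" for p
    using awalk_imp_relpow[of "laakso n k" u p v] that assms(3) by (simp add: walk_rel_def)
  then have ge: "ereal (x / 4 ^ n) \<le> ?I"
    by (intro INF_greatest) (simp add: divide_right_mono)
  \<comment> \<open>The two bounds make the infimum finite, so \<open>real_of_ereal\<close> does not
    return its default value.\<close>
  obtain d where d: "?I = ereal d"
    using le ge by (cases ?I) auto
  show "laakso_dist n k u v \<le> real m / 4 ^ n" "x / 4 ^ n \<le> laakso_dist n k u v"
    using le ge unfolding laakso_dist_eq d by simp_all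
qed

section \<open>Cells filled by a vertex\<close>

text \<open>
  The base-4 digits of \<open>t < 4\<^sup>n\<close> select successively a quarter at each level, the digit of level
  \<open>p\<close> being \<open>t div 4 ^ (n - Suc p) mod 4\<close>. An edge of level \<open>p\<close> has maximal endpoint depth \<open>p\<close>.
\<close>

primrec role_mask :: "laakso_role \<Rightarrow> nat set \<Rightarrow> bool \<Rightarrow> nat \<Rightarrow> bool" where
  "role_mask S1 S \<sigma> d \<longleftrightarrow> d = 0"
| "role_mask T1 S \<sigma> d \<longleftrightarrow> d \<noteq> 3"
| "role_mask (V i) S \<sigma> d \<longleftrightarrow> d = 0 \<or> d = (if (i \<in> S) = \<sigma> then 2 else 1)"

text \<open>The cells belonging to the edge \<open>uv\<close> need no separate record: they are
  those filled at \<open>v\<close> and not at \<open>u\<close>, and the role decides which quarters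
  of them are already filled.\<close>

primrec filled :: "nat \<Rightarrow> laakso_vertex \<Rightarrow> nat set \<Rightarrow> bool \<Rightarrow> nat \<Rightarrow> bool" where
  "filled n Source S \<sigma> t \<longleftrightarrow> False"
| "filled n Sink S \<sigma> t \<longleftrightarrow> t < 4 ^ n"
| "filled n (Inner u v l) S \<sigma> t \<longleftrightarrow> filled n u S \<sigma> t \<or> filled n v S \<sigma> t \<and>
     role_mask l S \<sigma> (t div 4 ^ (n - Suc (max (laakso_depth u) (laakso_depth v))) mod 4)"

text \<open>
  In the block \<open>(S, \<sigma>)\<close>, the cells filled by \<open>b\<close> but not by \<open>a\<close> are those with prefix \<open>w S \<sigma>\<close>.
\<close>

definition edge_label :: "nat \<Rightarrow> nat \<Rightarrow> (nat set \<Rightarrow> bool \<Rightarrow> nat) \<Rightarrow> laakso_vertex \<Rightarrow> laakso_vertex \<Rightarrow> bool" where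
  "edge_label n p w a b \<longleftrightarrow> max (laakso_depth a) (laakso_depth b) = p \<and>
     (\<forall>S \<sigma>. w S \<sigma> < 4 ^ p \<and>
       (\<forall>t. filled n b S \<sigma> t = (t div 4 ^ (n - p) = w S \<sigma> \<or> filled n a S \<sigma> t) \<and>
            (t div 4 ^ (n - p) = w S \<sigma> \<longrightarrow> \<not> filled n a S \<sigma> t)))"

lemma edge_label_Source_Sink: "edge_label n 0 (\<lambda>S \<sigma>. 0) Source Sink"
  by (auto simp: edge_label_def div_eq_0_iff)

section \<open>Paths through one cell and base-4 digits\<close>

definition cell_vertex :: "laakso_vertex \<Rightarrow> laakso_vertex \<Rightarrow> nat \<Rightarrow> nat \<Rightarrow> laakso_vertex" where
  "cell_vertex a b i r =
     [a, Inner a b S1, Inner a b (V i), Inner a b T1, b] ! r"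

definition cell_mask :: "nat \<Rightarrow> nat \<Rightarrow> nat set \<Rightarrow> bool \<Rightarrow> nat \<Rightarrow> bool" where
  "cell_mask i r S \<sigma> =
     [\<lambda>_. False, role_mask S1 S \<sigma>, role_mask (V i) S \<sigma>, role_mask T1 S \<sigma>, \<lambda>_. True] ! r"

text \<open>The quarter filled along edge \<open>r\<close> of the path through branch
  \<open>i\<close>. The middle quarters come in the order 2, 1 when
  \<open>(i \<in> S) = \<sigma>\<close> and in the order 1, 2 otherwise.\<close>

definition cell_digit :: "nat \<Rightarrow> nat \<Rightarrow> nat set \<Rightarrow> bool \<Rightarrow> nat" where
  "cell_digit i r S \<sigma> =
     [0, if (i \<in> S) = \<sigma> then 2 else 1, if (i \<in> S) = \<sigma> then 1 else 2, 3] ! r"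

lemma less_4_cases: "(r::nat) < 4 \<Longrightarrow> r = 0 \<or> r = 1 \<or> r = 2 \<or> r = 3"
  by auto

lemma subarcs_eq:
  assumes "k \<ge> 1"
  shows "subarcs k (a, b) =
    {(cell_vertex a b i r, cell_vertex a b i (Suc r)) | i r. i \<in> {1..k} \<and> r < 4}" (is "_ = ?A")
proof -
  have "?A = (\<Union>i\<in>{1..k}. (\<lambda>r. (cell_vertex a b i r, cell_vertex a b i (Suc r))) ` {..<4})"
    by blast
  also have "\<dots> = (\<Union>i\<in>{1..k}. (\<lambda>r. (cell_vertex a b i r, cell_vertex a b i (Suc r))) ` {0, 1, 2, 3})"
    by (intro SUP_cong arg_cong2[of _ _ _ _ "(`)"] refl) auto
  also have "\<dots> = subarcs k (a, b)"
    using assms by (auto simp: cell_vertex_def laakso_cell_def Let_def)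
  finally show ?thesis ..
qed

lemma cell_digit_less: "r < 4 \<Longrightarrow> cell_digit i r S \<sigma> < 4"
  by (auto dest!: less_4_cases simp: cell_digit_def)

lemma cell_mask_Suc:
  "r < 4 \<Longrightarrow> d < 4 \<Longrightarrow> cell_mask i (Suc r) S \<sigma> d \<longleftrightarrow> cell_mask i r S \<sigma> d \<or> d = cell_digit i r S \<sigma>"
  by (auto dest!: less_4_cases simp: cell_mask_def cell_digit_def)

lemma cell_mask_digit: "r < 4 \<Longrightarrow> \<not> cell_mask i r S \<sigma> (cell_digit i r S \<sigma>)"
  by (auto dest!: less_4_cases simp: cell_mask_def cell_digit_def)

lemma filled_cell_vertex:
  assumes "edge_label n p w a b" "p < n" "r < 5"
  shows "filled n (cell_vertex a b i r) S \<sigma> t \<longleftrightarrow> filled n a S \<sigma> t \<or>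
    t div 4 ^ (n - p) = w S \<sigma> \<and> cell_mask i r S \<sigma> (t div 4 ^ (n - Suc p) mod 4)"
proof -
  have "max (laakso_depth a) (laakso_depth b) = p"
    using assms(1) by (simp add: edge_label_def)
  moreover have "filled n b S \<sigma> t = (t div 4 ^ (n - p) = w S \<sigma> \<or> filled n a S \<sigma> t)"
    using assms(1) by (simp add: edge_label_def)
  moreover have "r = 0 \<or> r = 1 \<or> r = 2 \<or> r = 3 \<or> r = 4" using assms(3) by auto
  ultimately show ?thesis
    by (elim disjE) (simp_all add: cell_vertex_def cell_mask_def del: role_mask.simps, blast+)
qed

lemma div_4_power_Suc: "t div 4 ^ Suc m = t div 4 ^ m div (4 :: nat)"
  by (simp only: power_Suc2 div_mult2_eq)

text \<open>Consecutive masks differ by exactly one digit, so the prefix of a subedge is the prefix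
  of the edge with that digit appended in base 4.\<close>

lemma edge_label_cell:
  assumes "edge_label n p w a b" "p < n" "r < 4"
  shows "edge_label n (Suc p) (\<lambda>S \<sigma>. 4 * w S \<sigma> + cell_digit i r S \<sigma>)
    (cell_vertex a b i r) (cell_vertex a b i (Suc r))"
  unfolding edge_label_def
proof (intro conjI allI)
  have "max (laakso_depth a) (laakso_depth b) = p"
    using assms(1) by (simp add: edge_label_def)
  then show "max (laakso_depth (cell_vertex a b i r)) (laakso_depth (cell_vertex a b i (Suc r))) = Suc p"
    using less_4_cases[OF assms(3)] by (auto simp: cell_vertex_def)
  fix S :: "nat set" and \<sigma> :: bool and t :: nat
  have dg: "cell_digit i r S \<sigma> < 4" using cell_digit_less[OF assms(3)] .
  show "4 * w S \<sigma> + cell_digit i r S \<sigma> < 4 ^ Suc p"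
  proof -
    have "w S \<sigma> < 4 ^ p" using assms(1) by (simp add: edge_label_def)
    then show ?thesis using dg by simp
  qed
  define q where "q = t div 4 ^ (n - Suc p)"
  have "n - p = Suc (n - Suc p)" using assms(2) by simp
  then have tq: "t div 4 ^ (n - p) = q div 4"
    by (simp only: q_def div_4_power_Suc)
  have q: "q = 4 * w S \<sigma> + cell_digit i r S \<sigma> \<longleftrightarrow> q div 4 = w S \<sigma> \<and> q mod 4 = cell_digit i r S \<sigma>"
  proof
    assume *: "q div 4 = w S \<sigma> \<and> q mod 4 = cell_digit i r S \<sigma>"
    have "q = 4 * (q div 4) + q mod 4" by simp
    then show "q = 4 * w S \<sigma> + cell_digit i r S \<sigma>" unfolding conjunct1[OF *] conjunct2[OF *] .
  qed (use dg in simp)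
  have fa: "q div 4 = w S \<sigma> \<longrightarrow> \<not> filled n a S \<sigma> t"
    using assms(1) tq by (simp add: edge_label_def)
  show "filled n (cell_vertex a b i (Suc r)) S \<sigma> t =
      (t div 4 ^ (n - Suc p) = 4 * w S \<sigma> + cell_digit i r S \<sigma> \<or> filled n (cell_vertex a b i r) S \<sigma> t)"
    and "t div 4 ^ (n - Suc p) = 4 * w S \<sigma> + cell_digit i r S \<sigma> \<longrightarrow> \<not> filled n (cell_vertex a b i r) S \<sigma> t"
    using filled_cell_vertex[OF assms(1,2), of r i S \<sigma> t] filled_cell_vertex[OF assms(1,2), of "Suc r" i S \<sigma> t]
      cell_mask_Suc[OF assms(3), of "q mod 4" i S \<sigma>] cell_mask_digit[OF assms(3), of i S \<sigma>] fa assms(3)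
    unfolding q_def[symmetric] tq q by auto
qed

section \<open>Counting filled cells in intervals\<close>

definition fill :: "nat \<Rightarrow> laakso_vertex \<Rightarrow> nat set \<Rightarrow> bool \<Rightarrow> nat \<Rightarrow> nat \<Rightarrow> int" where
  "fill n v S \<sigma> a b = (\<Sum>t=a..<b. of_bool (filled n v S \<sigma> t))"

lemma fill_split: "a \<le> b \<Longrightarrow> b \<le> c \<Longrightarrow> fill n v S \<sigma> a c = fill n v S \<sigma> a b + fill n v S \<sigma> b c"
  unfolding fill_def by (simp only: sum.atLeastLessThan_concat)

lemma in_block_div: "w * q \<le> t \<Longrightarrow> t < Suc w * q \<Longrightarrow> t div q = (w::nat)"
  by (simp add: div_nat_eqI mult.commute)

text \<open>Describes a vertex \<open>v\<close> inside the subdivided edge that starts at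
  \<open>a\<close> and has prefix \<open>w\<close>: it differs from \<open>a\<close> only in the
  block of that prefix, and \<open>x\<close> will turn out to be its position along the
  edge.\<close>

definition located :: "nat \<Rightarrow> nat \<Rightarrow> (nat set \<Rightarrow> bool \<Rightarrow> nat) \<Rightarrow> laakso_vertex \<Rightarrow> laakso_vertex \<Rightarrow> nat \<Rightarrow> bool" where
  "located n m w a v x \<longleftrightarrow> (\<forall>S \<sigma>.
     (\<forall>t. t div 4 ^ m \<noteq> w S \<sigma> \<longrightarrow> filled n v S \<sigma> t = filled n a S \<sigma> t) \<and>
     fill n v S \<sigma> (w S \<sigma> * 4 ^ m) (Suc (w S \<sigma>) * 4 ^ m) = int x)"

lemma located_left:
  assumes "located n m w a v x" "c \<le> w S \<sigma> * 4 ^ m"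
  shows "fill n v S \<sigma> b c = fill n a S \<sigma> b c"
  unfolding fill_def
proof (rule sum.cong)
  fix t assume "t \<in> {b..<c}"
  then have "t < w S \<sigma> * 4 ^ m" using assms(2) by simp
  then have "t div 4 ^ m < w S \<sigma>" by (simp add: less_mult_imp_div_less)
  then show "of_bool (filled n v S \<sigma> t) = (of_bool (filled n a S \<sigma> t) :: int)"
    using assms(1) by (simp add: located_def)
qed simp

lemma located_right:
  assumes "located n m w a v x" "Suc (w S \<sigma>) * 4 ^ m \<le> b"
  shows "fill n v S \<sigma> b c = fill n a S \<sigma> b c"
  unfolding fill_def
proof (rule sum.cong)
  fix t assume "t \<in> {b..<c}"
  then have "Suc (w S \<sigma>) * 4 ^ m \<le> t" using assms(2) by simp
  then have "Suc (w S \<sigma>) \<le> t div 4 ^ m" by (simp add: less_eq_div_iff_mult_less_eq)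
  then show "of_bool (filled n v S \<sigma> t) = (of_bool (filled n a S \<sigma> t) :: int)"
    using assms(1) by (simp add: located_def)
qed simp

lemma edge_label_block_le:
  assumes "edge_label n p w a b" "n = p + m"
  shows "Suc (w S \<sigma>) * 4 ^ m \<le> 4 ^ n"
proof -
  have "Suc (w S \<sigma>) \<le> 4 ^ p" using assms(1) by (simp add: edge_label_def Suc_leI)
  then have "Suc (w S \<sigma>) * 4 ^ m \<le> 4 ^ p * 4 ^ m" by (rule mult_le_mono1)
  then show ?thesis by (simp add: assms(2) power_add)
qed

lemma edge_label_block_empty:
  assumes "edge_label n p w a b" "n = p + m"
  shows "fill n a S \<sigma> (w S \<sigma> * 4 ^ m) (Suc (w S \<sigma>) * 4 ^ m) = 0"
  unfolding fill_def
proof (rule sum.neutral, intro ballI)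
  fix t assume "t \<in> {w S \<sigma> * 4 ^ m..<Suc (w S \<sigma>) * 4 ^ m}"
  then have "t div 4 ^ m = w S \<sigma>" by (intro in_block_div) auto
  then show "of_bool (filled n a S \<sigma> t) = (0::int)"
    using assms by (simp add: edge_label_def)
qed

lemma located_total:
  assumes "edge_label n p w a b" "n = p + m" "located n m w a v x"
  shows "fill n v S \<sigma> 0 (4 ^ n) = fill n a S \<sigma> 0 (4 ^ n) + int x"
proof -
  let ?l = "w S \<sigma> * 4 ^ m" and ?r = "Suc (w S \<sigma>) * 4 ^ m"
  have split: "fill n u S \<sigma> 0 (4 ^ n) = fill n u S \<sigma> 0 ?l + (fill n u S \<sigma> ?l ?r + fill n u S \<sigma> ?r (4 ^ n))" for u
    using edge_label_block_le[OF assms(1,2), of S \<sigma>]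
    by (metis fill_split le0 le_add2 mult_Suc order_trans)
  show ?thesis
    unfolding split[of v] split[of a]
    using located_left[OF assms(3) order_refl] located_right[OF assms(3) order_refl]
      edge_label_block_empty[OF assms(1,2)] assms(3) by (simp add: located_def)
qed

lemma located_start:
  assumes "edge_label n p w a b" "n = p + m"
  shows "located n m w a a 0"
  using edge_label_block_empty[OF assms] by (simp add: located_def)

lemma located_end:
  assumes "edge_label n n w a b"
  shows "located n 0 w a b 1"
  using assms by (simp add: located_def edge_label_def fill_def)

text \<open>Outside the quarter being filled, \<open>v\<close> agrees with
  \<open>cell_vertex a b i r\<close>, whose mask is constant on each quarter.\<close>

lemma located_digit:
  assumes ab: "edge_label n p w a b" and n: "n = p + Suc m" and r: "r < 4"
    and v: "located n m (\<lambda>S \<sigma>. 4 * w S \<sigma> + cell_digit i r S \<sigma>) (cell_vertex a b i r) v x"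
    and d: "d < 4" "e = Suc d"
  shows "fill n v S \<sigma> ((4 * w S \<sigma> + d) * 4 ^ m) ((4 * w S \<sigma> + e) * 4 ^ m) =
    (if d = cell_digit i r S \<sigma> then int x else if cell_mask i r S \<sigma> d then 4 ^ m else 0)"
proof (cases "d = cell_digit i r S \<sigma>")
  case True
  then show ?thesis using v by (simp add: located_def d)
next
  case False
  have "filled n v S \<sigma> t = cell_mask i r S \<sigma> d"
    if "t \<in> {(4 * w S \<sigma> + d) * 4 ^ m..<(4 * w S \<sigma> + e) * 4 ^ m}" for t
  proof -
    have t: "t div 4 ^ m = 4 * w S \<sigma> + d" using that by (intro in_block_div) (auto simp: d)
    then have "t div 4 ^ Suc m = w S \<sigma>"
      using d by (simp add: div_4_power_Suc del: power_Suc)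
    moreover have "filled n v S \<sigma> t = filled n (cell_vertex a b i r) S \<sigma> t"
      using v t False by (simp add: located_def)
    moreover have "n - p = Suc m" "n - Suc p = m" "p < n" using n by auto
    moreover have "t div 4 ^ (n - p) = w S \<sigma> \<Longrightarrow> \<not> filled n a S \<sigma> t"
      using ab by (simp add: edge_label_def)
    ultimately show ?thesis
      using filled_cell_vertex[OF ab, of r i S \<sigma> t] r d t by simp
  qed
  then have "fill n v S \<sigma> ((4 * w S \<sigma> + d) * 4 ^ m) ((4 * w S \<sigma> + e) * 4 ^ m) =
      (\<Sum>t=(4 * w S \<sigma> + d) * 4 ^ m..<(4 * w S \<sigma> + e) * 4 ^ m. of_bool (cell_mask i r S \<sigma> d))"
    unfolding fill_def by (intro sum.cong) auto
  then show ?thesis using False by (simp add: d)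
qed

text \<open>At position \<open>r\<close> of the path \<open>r\<close> quarters are full, whichever
  they are, and the current one contributes \<open>x\<close>.\<close>

lemma located_lift:
  assumes ab: "edge_label n p w a b" and n: "n = p + Suc m" and r: "r < 4"
    and v: "located n m (\<lambda>S \<sigma>. 4 * w S \<sigma> + cell_digit i r S \<sigma>) (cell_vertex a b i r) v x"
  shows "located n (Suc m) w a v (r * 4 ^ m + x)"
  unfolding located_def
proof (intro allI conjI impI)
  fix S \<sigma> and t :: nat
  assume t: "t div 4 ^ Suc m \<noteq> w S \<sigma>"
  have t4: "t div 4 ^ Suc m = t div 4 ^ m div 4" by (rule div_4_power_Suc)
  then have "t div 4 ^ m \<noteq> 4 * w S \<sigma> + cell_digit i r S \<sigma>"
    using t cell_digit_less[OF r, of i S \<sigma>] by auto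
  then have "filled n v S \<sigma> t = filled n (cell_vertex a b i r) S \<sigma> t"
    using v by (simp add: located_def)
  moreover have "n - p = Suc m" "p < n" using n by auto
  ultimately show "filled n v S \<sigma> t = filled n a S \<sigma> t"
    using filled_cell_vertex[OF ab, of r i S \<sigma> t] r t by simp
next
  fix S \<sigma>
  let ?q = "4 ^ m :: nat"
  let ?f = "\<lambda>c d. fill n v S \<sigma> ((4 * w S \<sigma> + c) * ?q) ((4 * w S \<sigma> + d) * ?q)"
  define g where "g d = (if d = cell_digit i r S \<sigma> then int x else if cell_mask i r S \<sigma> d then 4 ^ m else 0)" for d
  have f_eq: "?f d e = g d" if "d < 4" "e = Suc d" for d e
    unfolding g_def by (rule located_digit[OF ab n r v that])
  have "fill n v S \<sigma> (w S \<sigma> * 4 ^ Suc m) (Suc (w S \<sigma>) * 4 ^ Suc m) = ?f 0 4"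
    by (simp add: algebra_simps)
  also have "\<dots> = ?f 0 1 + (?f 1 2 + (?f 2 3 + ?f 3 4))"
  proof -
    have "?f c e = ?f c d + ?f d e" if "c \<le> d" "d \<le> e" for c d e
      using that by (intro fill_split mult_le_mono1) auto
    from this[of 0 1 4] this[of 1 2 4] this[of 2 3 4] show ?thesis
      by linarith
  qed
  also have "\<dots> = g 0 + (g 1 + (g 2 + g 3))"
    using f_eq[of 0 1] f_eq[of 1 2] f_eq[of 2 3] f_eq[of 3 4] by linarith
  also have "\<dots> = int (r * 4 ^ m + x)"
    using less_4_cases[OF r]
    by (cases "(i \<in> S) = \<sigma>"; elim disjE) (simp_all add: g_def cell_digit_def cell_mask_def)
  finally show "fill n v S \<sigma> (w S \<sigma> * 4 ^ Suc m) (Suc (w S \<sigma>) * 4 ^ Suc m) = int (r * 4 ^ m + x)" .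
qed

text \<open>Here \<open>y\<close> is the position beyond the first quarter of the path. If
  \<open>(i \<in> S) = \<sigma>\<close>, quarter 2 is filled before quarter 1, so the first half of
  the block receives only the excess of \<open>y\<close> over \<open>4 ^ m\<close>; otherwise it
  receives the first \<open>4 ^ m\<close> of \<open>y\<close>.\<close>

lemma located_half:
  assumes ab: "edge_label n p w a b" and n: "n = p + Suc m" and r: "r = 1 \<or> r = 2"
    and v: "located n m (\<lambda>S \<sigma>. 4 * w S \<sigma> + cell_digit i r S \<sigma>) (cell_vertex a b i r) v x"
    and x: "x \<le> 4 ^ m" and y: "y = (r - 1) * 4 ^ m + x"
  shows "fill n v S \<sigma> (w S \<sigma> * 4 ^ Suc m) ((4 * w S \<sigma> + 2) * 4 ^ m) =
    4 ^ m + (if (i \<in> S) = \<sigma> then int y - min (int y) (4 ^ m) else min (int y) (4 ^ m))"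
proof -
  have r4: "r < 4" using r by auto
  let ?q = "4 ^ m :: nat"
  let ?f = "\<lambda>c d. fill n v S \<sigma> ((4 * w S \<sigma> + c) * ?q) ((4 * w S \<sigma> + d) * ?q)"
  define g where "g d = (if d = cell_digit i r S \<sigma> then int x else if cell_mask i r S \<sigma> d then 4 ^ m else 0)" for d
  have f_eq: "?f d e = g d" if "d < 4" "e = Suc d" for d e
    unfolding g_def by (rule located_digit[OF ab n r4 v that])
  have "fill n v S \<sigma> (w S \<sigma> * 4 ^ Suc m) ((4 * w S \<sigma> + 2) * 4 ^ m) = ?f 0 2"
    by (simp add: algebra_simps)
  also have "\<dots> = ?f 0 1 + ?f 1 2"
  proof -
    have "?f c e = ?f c d + ?f d e" if "c \<le> d" "d \<le> e" for c d e
      using that by (intro fill_split mult_le_mono1) auto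
    from this[of 0 1 2] show ?thesis
      by linarith
  qed
  also have "\<dots> = g 0 + g 1"
    using f_eq[of 0 1] f_eq[of 1 2] by linarith
  also have "\<dots> = 4 ^ m + (if (i \<in> S) = \<sigma> then int y - min (int y) (4 ^ m) else min (int y) (4 ^ m))"
  proof -
    have "int x \<le> 4 ^ m" using x by (metis of_nat_le_iff of_nat_numeral of_nat_power)
    then have "r = 1 \<and> min (int y) (4 ^ m) = int x \<and> int y = int x \<or>
        r = 2 \<and> min (int y) (4 ^ m) = 4 ^ m \<and> int y = 4 ^ m + int x"
      using r y by (elim disjE) (simp_all add: min_def)
    then show ?thesis
      by (cases "(i \<in> S) = \<sigma>"; elim disjE conjE) (simp_all add: g_def cell_digit_def cell_mask_def)
  qed
  finally show ?thesis .
qed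

section \<open>Walks inside a subdivided edge\<close>

lemma relpow_sym: "sym R \<Longrightarrow> (u, v) \<in> R ^^ m \<Longrightarrow> (v, u) \<in> R ^^ m"
proof (induction m arbitrary: v)
  case (Suc m)
  then obtain y where "(u, y) \<in> R ^^ m" "(y, v) \<in> R" by auto
  then show ?case
    using Suc.IH[OF Suc.prems(1)] symD[OF Suc.prems(1)] by (blast intro: relpow_Suc_I2)
qed simp

lemma relpow_trans: "(u, v) \<in> R ^^ l \<Longrightarrow> (v, w) \<in> R ^^ m \<Longrightarrow> (u, w) \<in> R ^^ (l + m)"
  by (auto simp: relpow_add)

lemma cell_vertex_ends [simp]: "cell_vertex a b i 0 = a" "cell_vertex a b i 4 = b"
  by (simp_all add: cell_vertex_def)

lemma cell_vertex_branch: "r \<noteq> 2 \<Longrightarrow> r < 5 \<Longrightarrow> cell_vertex a b i r = cell_vertex a b j r"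
proof -
  assume "r \<noteq> 2" "r < 5"
  then have "r = 0 \<or> r = 1 \<or> r = 3 \<or> r = 4" by auto
  then show ?thesis by (auto simp: cell_vertex_def)
qed

lemma cell_walk:
  assumes "\<And>r. r < 4 \<Longrightarrow> (cell_vertex a b i r, cell_vertex a b i (Suc r)) \<in> R ^^ q"
    and "r \<le> r'" "r' \<le> 4"
  shows "(cell_vertex a b i r, cell_vertex a b i r') \<in> R ^^ ((r' - r) * q)"
  using assms(2,3)
proof (induction r' rule: dec_induct)
  case (step r')
  then have "(cell_vertex a b i r, cell_vertex a b i (Suc r')) \<in> R ^^ ((r' - r) * q + q)"
    by (intro relpow_trans[OF step.IH assms(1)]) auto
  then show ?case using step by (simp add: Suc_diff_le add.commute)
qed simp

lemma expand_cell:
  assumes "i \<in> {1..k}" "r < 4"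
  shows "expand k m (cell_vertex a b i r, cell_vertex a b i (Suc r)) \<subseteq> expand k (Suc m) (a, b)"
  using subarcs_eq[of k a b] assms by auto

lemma expand_walk:
  assumes "k \<ge> 1" "expand k m (a, b) \<subseteq> R"
  shows "(a, b) \<in> R ^^ (4 ^ m)"
  using assms(2)
proof (induction m arbitrary: a b)
  case (Suc m)
  have "(cell_vertex a b 1 r, cell_vertex a b 1 (Suc r)) \<in> R ^^ (4 ^ m)" if "r < 4" for r
    using expand_cell[of 1 k r m a b] Suc.prems that assms(1) by (intro Suc.IH) auto
  from cell_walk[OF this, of 0 4] show ?case by simp
qed simp

lemma endpoints_expand_Suc:
  assumes "k \<ge> 1" "v \<in> endpoints (expand k (Suc m) (a, b))"
  obtains i r where "i \<in> {1..k}" "r < 4"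
    "v \<in> endpoints (expand k m (cell_vertex a b i r, cell_vertex a b i (Suc r)))"
proof -
  obtain e where "e \<in> subarcs k (a, b)" "v \<in> endpoints (expand k m e)"
    using assms(2) by (auto simp: endpoints_UN)
  then show ?thesis using that unfolding subarcs_eq[OF assms(1)] by auto
qed

text \<open>Each vertex lies on a walk of length \<open>4 ^ m\<close> from \<open>a\<close> to
  \<open>b\<close>, and its position there is also its number of filled cells. In the induction,
  \<open>r\<close> whole quarters precede the subedge containing \<open>v\<close> and
  \<open>3 - r\<close> follow it.\<close>

lemma endpoint_position:
  assumes "k \<ge> 1" "edge_label n p w a b" "n = p + m" "expand k m (a, b) \<subseteq> R"
    and "v \<in> endpoints (expand k m (a, b))"
  shows "\<exists>x\<le>4 ^ m. located n m w a v x \<and> (a, v) \<in> R ^^ x \<and> (v, b) \<in> R ^^ (4 ^ m - x)"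
  using assms(2-)
proof (induction m arbitrary: a b p w)
  case 0
  then have "v = a \<or> v = b" by (auto simp: endpoints_def)
  then show ?case
  proof
    assume "v = a"
    then show ?thesis
      using 0 located_start[of n p w a b 0] by (intro exI[of _ 0]) auto
  next
    assume "v = b"
    then show ?thesis
      using 0 located_end[of n w a b] by (intro exI[of _ 1]) auto
  qed
next
  case (Suc m)
  obtain i r where ir: "i \<in> {1..k}" "r < 4"
    "v \<in> endpoints (expand k m (cell_vertex a b i r, cell_vertex a b i (Suc r)))"
    using endpoints_expand_Suc[OF assms(1) Suc.prems(4)] .
  have sub: "expand k m (cell_vertex a b i r, cell_vertex a b i (Suc r)) \<subseteq> R" if "r < 4" for r
    using expand_cell[OF ir(1) that, of m a b] Suc.prems(3) by blast
  have lab: "edge_label n (Suc p) (\<lambda>S \<sigma>. 4 * w S \<sigma> + cell_digit i r S \<sigma>)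
      (cell_vertex a b i r) (cell_vertex a b i (Suc r))"
    using edge_label_cell[OF Suc.prems(1) _ ir(2)] Suc.prems(2) by simp
  obtain x where x: "x \<le> 4 ^ m"
    "located n m (\<lambda>S \<sigma>. 4 * w S \<sigma> + cell_digit i r S \<sigma>) (cell_vertex a b i r) v x"
    "(cell_vertex a b i r, v) \<in> R ^^ x" "(v, cell_vertex a b i (Suc r)) \<in> R ^^ (4 ^ m - x)"
    using Suc.IH[OF lab _ sub[OF ir(2)] ir(3)] Suc.prems(2) by auto
  have walk: "s \<le> s' \<Longrightarrow> s' \<le> 4 \<Longrightarrow> (cell_vertex a b i s, cell_vertex a b i s') \<in> R ^^ ((s' - s) * 4 ^ m)" for s s'
    using cell_walk[of a b i "4 ^ m" R s s'] expand_walk[OF assms(1) sub] by blast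
  have "r = 0 \<or> r = 1 \<or> r = 2 \<or> r = 3" using ir(2) by auto
  then have len: "4 ^ m - x + (4 - Suc r) * 4 ^ m = 4 ^ Suc m - (r * 4 ^ m + x)" and
    le: "r * 4 ^ m + x \<le> 4 ^ Suc m"
    using x(1) by auto
  have "(a, v) \<in> R ^^ (r * 4 ^ m + x)"
    using relpow_trans[OF walk[of 0 r] x(3)] ir(2) by simp
  moreover have "(v, b) \<in> R ^^ (4 ^ Suc m - (r * 4 ^ m + x))"
    using relpow_trans[OF x(4) walk[of "Suc r" 4]] ir(2) unfolding len by simp
  ultimately show ?case
    using located_lift[OF Suc.prems(1,2) ir(2) x(2)] le by blast
qed

section \<open>Separation of vertices\<close>

text \<open>
  For the pairs in \<open>G\<close>, the part of the positive block after \<open>\<tau>\<close> cancels against the part of the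
  negative block before \<open>\<tau>\<close>, since all block sums agree; what remains is \<open>\<alpha>\<close> and \<open>- \<alpha>\<close>. The other
  pairs cancel completely.
\<close>

definition separated :: "nat \<Rightarrow> nat \<Rightarrow> (laakso_vertex \<times> laakso_vertex) set \<Rightarrow> laakso_vertex \<Rightarrow> laakso_vertex \<Rightarrow> bool" where
  "separated n k R u v \<longleftrightarrow> (\<exists>G \<alpha> L \<tau> \<delta>.
     G \<subseteq> Pow {1..k} \<and> card G = 2 ^ (k - 2) \<and> (u, v) \<in> R ^^ L \<and> L \<le> 2 * \<alpha> \<and>
     (\<forall>S\<in>G. \<tau> S True \<le> 4 ^ n \<and> fill n u S True 0 (\<tau> S True) - fill n v S True 0 (\<tau> S True) = int \<alpha>) \<and>
     (\<forall>S\<in>G. \<tau> S False \<le> 4 ^ n \<and>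
        fill n u S False (\<tau> S False) (4 ^ n) - fill n v S False (\<tau> S False) (4 ^ n) = int \<alpha>) \<and>
     (\<forall>S \<sigma>. fill n u S \<sigma> 0 (4 ^ n) - fill n v S \<sigma> 0 (4 ^ n) = \<delta>))"

text \<open>If \<open>u\<close> lies beyond \<open>v\<close>, every block has the surplus
  \<open>x - y\<close>. Hence any family of the right size serves as \<open>G\<close>, with the
  whole positive block as prefix and the whole negative block as suffix.\<close>

lemma separated_comparable:
  assumes "edge_label n p w a b" "n = p + m" "located n m w a u x" "located n m w a v y"
    and "y \<le> x" "(u, v) \<in> R ^^ (x - y)"
  shows "separated n k R u v"
proof -
  have "2 ^ (k - 2) \<le> card (Pow {1..k})"
    by (simp add: card_Pow)
  then obtain G where G: "G \<subseteq> Pow {1..k}" "card G = 2 ^ (k - 2)"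
    using obtain_subset_with_card_n by metis
  have "fill n u S \<sigma> 0 (4 ^ n) - fill n v S \<sigma> 0 (4 ^ n) = int (x - y)" for S \<sigma>
    using located_total[OF assms(1,2,3)] located_total[OF assms(1,2,4)] assms(5) by simp
  then show ?thesis
    unfolding separated_def using G assms(6)
    by (intro exI[of _ G] exI[of _ "x - y"] exI[of _ "\<lambda>S \<sigma>. if \<sigma> then 4 ^ n else 0"] exI[of _ "int (x - y)"]) auto
qed

lemma card_subsets_avoid_contain:
  assumes "i \<in> A" "j \<in> A" "i \<noteq> j" "finite A"
  shows "card {S \<in> Pow A. i \<notin> S \<and> j \<in> S} = 2 ^ (card A - 2)"
proof -
  have "{S \<in> Pow A. i \<notin> S \<and> j \<in> S} = insert j ` Pow (A - {i, j})" (is "?L = ?R")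
  proof (rule set_eqI, rule iffI)
    fix S assume "S \<in> ?L"
    then have "S = insert j (S - {j})" "S - {j} \<in> Pow (A - {i, j})" by auto
    then show "S \<in> ?R" by (rule image_eqI)
  qed (use assms in auto)
  moreover have "inj_on (insert j) (Pow (A - {i, j}))"
    by (rule inj_onI) (auto simp: set_eq_iff)
  moreover have "card (A - {i, j}) = card A - 2"
    using assms by (simp add: card_Diff_subset)
  ultimately show ?thesis
    by (simp add: card_image card_Pow assms(4))
qed

text \<open>Take the pairs with \<open>i \<notin> S\<close> and \<open>j \<in> S\<close>, a quarter
  of all, and cut each block in the middle. In positive blocks \<open>u\<close> fills the first half
  first while \<open>v\<close> starts with the second half; in negative blocks the roles of the
  halves are exchanged. So the prefix of the former and the suffix of the latter show the same
  surplus \<open>\<alpha>\<close>.\<close>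

lemma separated_branches:
  assumes ab: "edge_label n p w a b" and n: "n = p + Suc m"
    and u: "located n (Suc m) w a u (4 ^ m + x)"
      "\<And>S \<sigma>. fill n u S \<sigma> (w S \<sigma> * 4 ^ Suc m) ((4 * w S \<sigma> + 2) * 4 ^ m) =
        4 ^ m + (if (i \<in> S) = \<sigma> then int x - min (int x) (4 ^ m) else min (int x) (4 ^ m))"
    and v: "located n (Suc m) w a v (4 ^ m + y)"
      "\<And>S \<sigma>. fill n v S \<sigma> (w S \<sigma> * 4 ^ Suc m) ((4 * w S \<sigma> + 2) * 4 ^ m) =
        4 ^ m + (if (j \<in> S) = \<sigma> then int y - min (int y) (4 ^ m) else min (int y) (4 ^ m))"
    and ij: "i \<in> {1..k}" "j \<in> {1..k}" "i \<noteq> j"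
    and xy: "y \<le> x" "x \<le> 2 * 4 ^ m"
    and walks: "(u, v) \<in> R ^^ (x + y)" "(u, v) \<in> R ^^ (4 * 4 ^ m - x - y)"
  shows "separated n k R u v"
proof -
  define G where "G = {S \<in> Pow {1..k}. i \<notin> S \<and> j \<in> S}"
  have G: "G \<subseteq> Pow {1..k}" "card G = 2 ^ (k - 2)"
    using card_subsets_avoid_contain[OF ij(1,2,3)] by (auto simp: G_def)
  define \<tau> where "\<tau> S \<sigma> = (4 * w S \<sigma> + 2) * 4 ^ m" for S \<sigma>
  have \<tau>: "w S \<sigma> * 4 ^ Suc m \<le> \<tau> S \<sigma>" "\<tau> S \<sigma> \<le> 4 ^ n" for S \<sigma>
  proof -
    show "w S \<sigma> * 4 ^ Suc m \<le> \<tau> S \<sigma>" by (simp add: \<tau>_def algebra_simps)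
    have "\<tau> S \<sigma> \<le> Suc (w S \<sigma>) * 4 ^ Suc m" by (simp add: \<tau>_def algebra_simps)
    then show "\<tau> S \<sigma> \<le> 4 ^ n"
      using edge_label_block_le[OF ab n, of S \<sigma>] by (rule order_trans)
  qed
  have total: "fill n u S \<sigma> 0 (4 ^ n) - fill n v S \<sigma> 0 (4 ^ n) = int x - int y" for S \<sigma>
    using located_total[OF ab n u(1)] located_total[OF ab n v(1)] by simp
  have prefix: "fill n u S \<sigma> 0 (\<tau> S \<sigma>) - fill n v S \<sigma> 0 (\<tau> S \<sigma>) =
      (if (i \<in> S) = \<sigma> then int x - min (int x) (4 ^ m) else min (int x) (4 ^ m)) -
      (if (j \<in> S) = \<sigma> then int y - min (int y) (4 ^ m) else min (int y) (4 ^ m))" for S \<sigma>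
  proof -
    have "fill n z S \<sigma> 0 (\<tau> S \<sigma>) = fill n z S \<sigma> 0 (w S \<sigma> * 4 ^ Suc m) + fill n z S \<sigma> (w S \<sigma> * 4 ^ Suc m) (\<tau> S \<sigma>)" for z
      using \<tau>(1) by (intro fill_split) auto
    then show ?thesis
      by (simp only: located_left[OF u(1) order_refl] located_left[OF v(1) order_refl]
          u(2)[of S \<sigma>, folded \<tau>_def] v(2)[of S \<sigma>, folded \<tau>_def] add_diff_cancel_left)
  qed
  have suffix: "fill n z S \<sigma> (\<tau> S \<sigma>) (4 ^ n) = fill n z S \<sigma> 0 (4 ^ n) - fill n z S \<sigma> 0 (\<tau> S \<sigma>)" for z S \<sigma>
    using fill_split[of 0 "\<tau> S \<sigma>" "4 ^ n" n z S \<sigma>] \<tau>(2) by simp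
  define \<alpha> where "\<alpha> = min x (4 ^ m) - (y - min y (4 ^ m))"
  have \<alpha>: "int \<alpha> = min (int x) (4 ^ m) - (int y - min (int y) (4 ^ m))"
  proof -
    have "y - min y (4 ^ m) \<le> min x (4 ^ m)" using xy by (auto simp: min_def)
    then show ?thesis
      unfolding \<alpha>_def by (simp only: of_nat_diff min.cobounded1 of_nat_min of_nat_power of_nat_numeral)
  qed
  \<comment> \<open>The shorter of the walks around the two ends. It is at most
    \<open>2 * \<alpha>\<close>, since \<open>\<alpha>\<close> equals \<open>x\<close> if
    \<open>x \<le> 4 ^ m\<close>, \<open>4 ^ m\<close> if \<open>y \<le> 4 ^ m \<le> x\<close>, and
    \<open>2 * 4 ^ m - y\<close> if \<open>4 ^ m \<le> y\<close>.\<close>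
  define L where "L = (if x + y \<le> 4 * 4 ^ m - x - y then x + y else 4 * 4 ^ m - x - y)"
  have L: "(u, v) \<in> R ^^ L" "L \<le> 2 * \<alpha>"
    using walks xy by (auto simp: L_def \<alpha>_def min_def)
  show ?thesis
    unfolding separated_def
  proof (rule exI[of _ G], rule exI[of _ \<alpha>], rule exI[of _ L], rule exI[of _ \<tau>],
      rule exI[of _ "int x - int y"], intro conjI ballI allI)
    fix S assume S: "S \<in> G"
    show "fill n u S True 0 (\<tau> S True) - fill n v S True 0 (\<tau> S True) = int \<alpha>"
      using S unfolding prefix \<alpha> by (simp add: G_def)
    show "fill n u S False (\<tau> S False) (4 ^ n) - fill n v S False (\<tau> S False) (4 ^ n) = int \<alpha>"
      using S prefix[of S False] total[of S False] unfolding suffix \<alpha> by (simp add: G_def)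
  qed (use G L \<tau>(2) total in auto)
qed

section \<open>Two vertices in the same cell\<close>

lemma position_cell:
  assumes "k \<ge> 1" "edge_label n p w a b" "n = p + Suc m" "expand k (Suc m) (a, b) \<subseteq> R"
    and "i \<in> {1..k}" "r < 4"
    and "v \<in> endpoints (expand k m (cell_vertex a b i r, cell_vertex a b i (Suc r)))"
  obtains x where "x \<le> 4 ^ m"
    "located n m (\<lambda>S \<sigma>. 4 * w S \<sigma> + cell_digit i r S \<sigma>) (cell_vertex a b i r) v x"
    "located n (Suc m) w a v (r * 4 ^ m + x)"
    "(cell_vertex a b i r, v) \<in> R ^^ x" "(v, cell_vertex a b i (Suc r)) \<in> R ^^ (4 ^ m - x)"
proof -
  have sub: "expand k m (cell_vertex a b i r, cell_vertex a b i (Suc r)) \<subseteq> R"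
    using expand_cell[OF assms(5,6), of m a b] assms(4) by blast
  have lab: "edge_label n (Suc p) (\<lambda>S \<sigma>. 4 * w S \<sigma> + cell_digit i r S \<sigma>)
      (cell_vertex a b i r) (cell_vertex a b i (Suc r))"
    using edge_label_cell[OF assms(2) _ assms(6)] assms(3) by simp
  have "n = Suc p + m" using assms(3) by simp
  from endpoint_position[OF assms(1) lab this sub assms(7)] obtain x where x: "x \<le> 4 ^ m"
    "located n m (\<lambda>S \<sigma>. 4 * w S \<sigma> + cell_digit i r S \<sigma>) (cell_vertex a b i r) v x"
    "(cell_vertex a b i r, v) \<in> R ^^ x" "(v, cell_vertex a b i (Suc r)) \<in> R ^^ (4 ^ m - x)"
    by blast
  then show ?thesis
    using that located_lift[OF assms(2,3,6) x(2)] by blast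
qed

lemma expand_cell_walk:
  assumes "k \<ge> 1" "expand k (Suc m) (a, b) \<subseteq> R" "i \<in> {1..k}" "r \<le> r'" "r' \<le> 4"
  shows "(cell_vertex a b i r, cell_vertex a b i r') \<in> R ^^ ((r' - r) * 4 ^ m)"
proof (rule cell_walk[OF _ assms(4,5)])
  fix r :: nat assume "r < 4"
  then have "expand k m (cell_vertex a b i r, cell_vertex a b i (Suc r)) \<subseteq> R"
    using expand_cell[OF assms(3), of r m a b] assms(2) by blast
  then show "(cell_vertex a b i r, cell_vertex a b i (Suc r)) \<in> R ^^ (4 ^ m)"
    by (rule expand_walk[OF assms(1)])
qed

text \<open>All branches share the path vertices other than the one at position 2. The last
  hypothesis therefore gives a direct walk from the end of the subedge of \<open>u\<close> to the
  start of that of \<open>v\<close>, and the two are comparable.\<close>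

lemma separated_cell_less:
  assumes k: "k \<ge> 1" and ab: "edge_label n p w a b" and n: "n = p + Suc m"
    and R: "sym R" "expand k (Suc m) (a, b) \<subseteq> R"
    and u: "i \<in> {1..k}" "r < 4" "u \<in> endpoints (expand k m (cell_vertex a b i r, cell_vertex a b i (Suc r)))"
    and v: "j \<in> {1..k}" "s < 4" "v \<in> endpoints (expand k m (cell_vertex a b j s, cell_vertex a b j (Suc s)))"
    and "r < s" and "i = j \<or> r = 0 \<or> s = 3"
  shows "separated n k R v u"
proof -
  obtain x where x: "x \<le> 4 ^ m" "located n (Suc m) w a u (r * 4 ^ m + x)"
    "(u, cell_vertex a b i (Suc r)) \<in> R ^^ (4 ^ m - x)"
    using position_cell[OF k ab n R(2) u] .
  obtain y where y: "y \<le> 4 ^ m" "located n (Suc m) w a v (s * 4 ^ m + y)"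
    "(cell_vertex a b j s, v) \<in> R ^^ y"
    using position_cell[OF k ab n R(2) v] .
  have "(cell_vertex a b i (Suc r), cell_vertex a b j s) \<in> R ^^ ((s - Suc r) * 4 ^ m)"
  proof (cases "r = 0")
    case True
    then have "cell_vertex a b i (Suc r) = cell_vertex a b j (Suc r)"
      by (intro cell_vertex_branch) auto
    then show ?thesis
      using expand_cell_walk[OF k R(2) v(1), of "Suc r" s] \<open>r < s\<close> v(2) by simp
  next
    case False
    then have "cell_vertex a b j s = cell_vertex a b i s"
      using assms(13) cell_vertex_branch[of s] by (cases "s = 3") auto
    then show ?thesis
      using expand_cell_walk[OF k R(2) u(1), of "Suc r" s] \<open>r < s\<close> v(2) by simp
  qed
  from relpow_trans[OF relpow_trans[OF x(3) this] y(3)]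
  have walk: "(u, v) \<in> R ^^ (4 ^ m - x + (s - Suc r) * 4 ^ m + y)" .
  obtain d where d: "s = Suc (r + d)" using \<open>r < s\<close> less_iff_Suc_add by auto
  have "4 ^ m - x + (s - Suc r) * 4 ^ m + y = s * 4 ^ m + y - (r * 4 ^ m + x)"
    and le: "r * 4 ^ m + x \<le> s * 4 ^ m + y"
    using x(1) unfolding d by (auto simp: algebra_simps)
  then show ?thesis
    using relpow_sym[OF R(1) walk] separated_comparable[OF ab n y(2) x(2) le] by simp
qed

text \<open>Positions \<open>x\<close> and \<open>y\<close> are measured from path position 1. The
  vertices can be joined through position 1 with length \<open>x + y\<close>, or through position 3
  with length \<open>4 * 4 ^ m - x - y\<close>.\<close>

lemma separated_cell_branches:
  assumes k: "k \<ge> 1" and ab: "edge_label n p w a b" and n: "n = p + Suc m"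
    and R: "sym R" "expand k (Suc m) (a, b) \<subseteq> R"
    and u: "i \<in> {1..k}" "r < 4" "u \<in> endpoints (expand k m (cell_vertex a b i r, cell_vertex a b i (Suc r)))"
    and v: "j \<in> {1..k}" "s < 4" "v \<in> endpoints (expand k m (cell_vertex a b j s, cell_vertex a b j (Suc s)))"
    and "i \<noteq> j" and r: "r = 1 \<or> r = 2" and s: "s = 1 \<or> s = 2"
  shows "separated n k R u v \<or> separated n k R v u"
proof -
  have br: "\<exists>x. x \<le> 2 * 4 ^ m \<and> located n (Suc m) w a u (4 ^ m + x) \<and>
      (\<forall>S \<sigma>. fill n u S \<sigma> (w S \<sigma> * 4 ^ Suc m) ((4 * w S \<sigma> + 2) * 4 ^ m) =
        4 ^ m + (if (i \<in> S) = \<sigma> then int x - min (int x) (4 ^ m) else min (int x) (4 ^ m))) \<and>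
      (cell_vertex a b 1 1, u) \<in> R ^^ x \<and> (u, cell_vertex a b 1 3) \<in> R ^^ (2 * 4 ^ m - x)"
    if u: "i \<in> {1..k}" "r < 4" "u \<in> endpoints (expand k m (cell_vertex a b i r, cell_vertex a b i (Suc r)))"
      and r: "r = 1 \<or> r = 2" for i r u
  proof -
    obtain x where x: "x \<le> 4 ^ m"
      "located n m (\<lambda>S \<sigma>. 4 * w S \<sigma> + cell_digit i r S \<sigma>) (cell_vertex a b i r) u x"
      "located n (Suc m) w a u (r * 4 ^ m + x)"
      "(cell_vertex a b i r, u) \<in> R ^^ x" "(u, cell_vertex a b i (Suc r)) \<in> R ^^ (4 ^ m - x)"
      using position_cell[OF k ab n R(2) u] .
    define y where "y = (r - 1) * 4 ^ m + x"
    have e1: "4 ^ m + y = r * 4 ^ m + x" and e2: "(3 - Suc r) * 4 ^ m + (4 ^ m - x) = 2 * 4 ^ m - y"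
      and y: "y \<le> 2 * 4 ^ m"
      using r x(1) by (auto simp: y_def)
    have "cell_vertex a b i 1 = cell_vertex a b 1 1" "cell_vertex a b i 3 = cell_vertex a b 1 3"
      by (intro cell_vertex_branch; simp)+
    then have "(cell_vertex a b 1 1, u) \<in> R ^^ y" "(u, cell_vertex a b 1 3) \<in> R ^^ (2 * 4 ^ m - y)"
      using relpow_trans[OF expand_cell_walk[OF k R(2) u(1), of 1 r] x(4)]
        relpow_trans[OF x(5) expand_cell_walk[OF k R(2) u(1), of "Suc r" 3]] r
      unfolding y_def[symmetric] e2[symmetric] by (auto simp: add.commute)
    then show ?thesis
      using y x(3) located_half[OF ab n r x(2,1) y_def] unfolding e1[symmetric] by blast
  qed
  obtain x where x: "x \<le> 2 * 4 ^ m" "located n (Suc m) w a u (4 ^ m + x)"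
      "\<And>S \<sigma>. fill n u S \<sigma> (w S \<sigma> * 4 ^ Suc m) ((4 * w S \<sigma> + 2) * 4 ^ m) =
        4 ^ m + (if (i \<in> S) = \<sigma> then int x - min (int x) (4 ^ m) else min (int x) (4 ^ m))"
      "(cell_vertex a b 1 1, u) \<in> R ^^ x" "(u, cell_vertex a b 1 3) \<in> R ^^ (2 * 4 ^ m - x)"
    using br[OF u r] by blast
  obtain y where y: "y \<le> 2 * 4 ^ m" "located n (Suc m) w a v (4 ^ m + y)"
      "\<And>S \<sigma>. fill n v S \<sigma> (w S \<sigma> * 4 ^ Suc m) ((4 * w S \<sigma> + 2) * 4 ^ m) =
        4 ^ m + (if (j \<in> S) = \<sigma> then int y - min (int y) (4 ^ m) else min (int y) (4 ^ m))"
      "(cell_vertex a b 1 1, v) \<in> R ^^ y" "(v, cell_vertex a b 1 3) \<in> R ^^ (2 * 4 ^ m - y)"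
    using br[OF v s] by blast
  have w1: "(u, v) \<in> R ^^ (x + y)"
    using relpow_trans[OF relpow_sym[OF R(1) x(4)] y(4)] .
  have "2 * 4 ^ m - x + (2 * 4 ^ m - y) = 4 * 4 ^ m - x - y"
    using x(1) y(1) by simp
  then have w2: "(u, v) \<in> R ^^ (4 * 4 ^ m - x - y)"
    using relpow_trans[OF x(5) relpow_sym[OF R(1) y(5)]] by simp
  show ?thesis
  proof (cases "y \<le> x")
    case True
    then show ?thesis
      using separated_branches[OF ab n x(2,3) y(2,3) u(1) v(1) \<open>i \<noteq> j\<close> True x(1) w1 w2] by simp
  next
    case False
    have "(v, u) \<in> R ^^ (y + x)" "(v, u) \<in> R ^^ (4 * 4 ^ m - y - x)"
      using relpow_sym[OF R(1) w1] relpow_sym[OF R(1) w2] by (simp_all add: add.commute diff_commute)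
    then show ?thesis
      using separated_branches[OF ab n y(2,3) x(2,3) v(1) u(1)] \<open>i \<noteq> j\<close> False y(1) by simp
  qed
qed

text \<open>Descend until the two vertices lie on different subedges of one cell. Either one then
  comes before the other on a common path, or they lie in the middle quarters of different
  branches.\<close>

lemma separated_or:
  assumes "k \<ge> 1" "edge_label n p w a b" "n = p + m" "sym R" "expand k m (a, b) \<subseteq> R"
    and "u \<in> endpoints (expand k m (a, b))" "v \<in> endpoints (expand k m (a, b))"
  shows "separated n k R u v \<or> separated n k R v u"
  using assms(2,3,5-)
proof (induction m arbitrary: a b p w)
  case 0
  have loc: "located n 0 w a a 0" "located n 0 w a b 1"
    using located_start[OF 0(1,2)] located_end[of n w a b] 0 by auto
  have "(a, b) \<in> R ^^ 1" using 0 by simp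
  then have "(b, a) \<in> R ^^ 1" using relpow_sym[OF assms(4)] by blast
  then have "separated n k R b a"
    using separated_comparable[OF 0(1,2) loc(2,1)] by simp
  moreover have "separated n k R a a" "separated n k R b b"
    using separated_comparable[OF 0(1,2) loc(1,1)] separated_comparable[OF 0(1,2) loc(2,2)] by simp_all
  ultimately show ?case using 0(4,5) by (auto simp: endpoints_def)
next
  case (Suc m)
  obtain i r where u: "i \<in> {1..k}" "r < 4"
    "u \<in> endpoints (expand k m (cell_vertex a b i r, cell_vertex a b i (Suc r)))"
    using endpoints_expand_Suc[OF assms(1) Suc.prems(4)] .
  obtain j s where v: "j \<in> {1..k}" "s < 4"
    "v \<in> endpoints (expand k m (cell_vertex a b j s, cell_vertex a b j (Suc s)))"
    using endpoints_expand_Suc[OF assms(1) Suc.prems(5)] .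
  note cell = assms(1) Suc.prems(1,2) assms(4) Suc.prems(3)
  have same: ?case if "i = j \<or> r \<notin> {1, 2}" "r = s"
  proof -
    have "cell_vertex a b j s = cell_vertex a b i r" "cell_vertex a b j (Suc s) = cell_vertex a b i (Suc r)"
      using that cell_vertex_branch[of r a b i j] cell_vertex_branch[of "Suc r" a b i j] u(2) by auto
    moreover have "edge_label n (Suc p) (\<lambda>S \<sigma>. 4 * w S \<sigma> + cell_digit i r S \<sigma>)
        (cell_vertex a b i r) (cell_vertex a b i (Suc r))"
      using edge_label_cell[OF Suc.prems(1) _ u(2)] Suc.prems(2) by simp
    moreover have "expand k m (cell_vertex a b i r, cell_vertex a b i (Suc r)) \<subseteq> R"
      using expand_cell[OF u(1,2), of m a b] Suc.prems(3) by blast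
    ultimately show ?thesis
      using Suc.IH[of "Suc p" _ "cell_vertex a b i r" "cell_vertex a b i (Suc r)"] u(3) v(3) Suc.prems(2) by auto
  qed
  consider "i = j \<or> r \<notin> {1, 2}" "r = s" | "r < s" "i = j \<or> r = 0 \<or> s = 3"
    | "s < r" "j = i \<or> s = 0 \<or> r = 3" | "i \<noteq> j" "r = 1 \<or> r = 2" "s = 1 \<or> s = 2"
    using u(2) v(2) less_4_cases[OF u(2)] less_4_cases[OF v(2)] by (cases "i = j") auto
  then show ?case
  proof cases
    case 2
    then show ?thesis using separated_cell_less[OF cell u v] by blast
  next
    case 3
    then show ?thesis using separated_cell_less[OF cell v u] by blast
  next
    case 4
    then show ?thesis using separated_cell_branches[OF cell u v] by blast
  qed (rule same)
qed

section \<open>The embedding\<close>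

lemma edge_label_expand:
  assumes "k \<ge> 1" "edge_label n p w a b" "n = p + m" "(u, v) \<in> expand k m (a, b)"
  shows "\<exists>w. edge_label n n w u v"
  using assms(2-)
proof (induction m arbitrary: p w a b)
  case (Suc m)
  obtain i r where ir: "r < 4" "(u, v) \<in> expand k m (cell_vertex a b i r, cell_vertex a b i (Suc r))"
    using Suc.prems(3) subarcs_eq[OF assms(1), of a b] by auto
  have "edge_label n (Suc p) (\<lambda>S \<sigma>. 4 * w S \<sigma> + cell_digit i r S \<sigma>)
      (cell_vertex a b i r) (cell_vertex a b i (Suc r))"
    using edge_label_cell[OF Suc.prems(1) _ ir(1)] Suc.prems(2) by simp
  from Suc.IH[OF this _ ir(2)] show ?case using Suc.prems(2) by simp
qed auto

lemma sum_list_zip_diff: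
  fixes ys :: "'a::real_vector list"
  shows "(\<Sum>(a, y)\<leftarrow>zip (map g xs) ys. a *\<^sub>R y) - (\<Sum>(a, y)\<leftarrow>zip (map h xs) ys. a *\<^sub>R y)
    = (\<Sum>(a, y)\<leftarrow>zip (map (\<lambda>x. g x - h x) xs) ys. a *\<^sub>R y)"
proof (induction xs arbitrary: ys)
  case (Cons x xs)
  then show ?case
    by (cases ys) (simp_all add: algebra_simps flip: Cons)
qed simp

lemma sum_list_zip_in_span: "(\<Sum>(a, y)\<leftarrow>zip as ys. a *\<^sub>R y) \<in> span (set ys)"
proof (induction as arbitrary: ys)
  case (Cons a as)
  show ?case
  proof (cases ys)
    case (Cons y ys')
    then have m: "(\<Sum>(a, y)\<leftarrow>zip as ys'. a *\<^sub>R y) \<in> span (set ys)"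
      using Cons.IH[of ys'] span_mono[of "set ys'" "set ys"] by auto
    have "y \<in> set ys" by (simp add: Cons)
    from span_add[OF span_scale[OF span_base[OF this], of a] m]
    show ?thesis by (simp add: Cons)
  qed (simp add: span_zero)
qed (simp add: span_zero)

lemma relpow_norm_le:
  assumes "\<And>u v. (u, v) \<in> R \<Longrightarrow> norm (f u - f v) \<le> B" "(u, v) \<in> R ^^ l"
  shows "norm (f u - f v) \<le> real l * B"
  using assms(2)
proof (induction l arbitrary: v)
  case (Suc l)
  then obtain w where "(u, w) \<in> R ^^ l" "(w, v) \<in> R" by auto
  then have "norm (f u - f w) \<le> real l * B" "norm (f w - f v) \<le> B"
    using Suc.IH assms(1) by auto
  then show ?case
    using norm_triangle_ineq[of "f u - f w" "f w - f v"] by (simp add: algebra_simps)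
qed simp

lemma sym_walk_rel: "sym (walk_rel n k)"
  by (auto simp: walk_rel_def intro: symI)

text \<open>The finite set \<open>B\<close> confines the image to a finite-dimensional subspace, as
  finite representability requires. The ratio 8 of the two constants, up to \<open>\<eta>\<close>,
  is 4 from the number of pairs times 2 from \<open>L \<le> 2 * \<alpha>\<close>.\<close>

lemma (in bidual_ultrafilter) ex_laakso_map:
  assumes \<eta>: "0 < \<eta>" "\<eta> < 1" and k: "k \<ge> 2"
  shows "\<exists>N>0. \<exists>B. \<exists>f :: laakso_vertex \<Rightarrow> 'y. finite B \<and> range f \<subseteq> span B \<and>
    (\<forall>(u, v)\<in>parcs (laakso n k). norm (f u - f v) \<le> 4 * (1 + \<eta>)\<^sup>2 * N) \<and>
    (\<forall>u\<in>pverts (laakso n k). \<forall>v\<in>pverts (laakso n k).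
       \<exists>L. (u, v) \<in> walk_rel n k ^^ L \<and> (1 - \<eta>) * N / 2 * real L \<le> norm (f u - f v))"
proof -
  \<comment> \<open>A quarter of the number of pairs, the size of the families \<open>G\<close> in
    \<open>separated\<close>; \<open>k \<ge> 2\<close> makes it exactly a quarter.\<close>
  define M :: nat where "M = 2 ^ (k - 2)"
  have "M > 0" by (simp add: M_def)
  then obtain N q where N: "N > 0" "\<And>q. q > 0 \<Longrightarrow> N \<le> alternating_norm q M"
    and q: "q > 0" "alternating_norm q M \<le> (1 + \<eta>) * N"
    using ex_alternating_norm_near_inf[OF _ \<eta>(1)] by metis
  obtain Ss :: "nat set list" where Ss: "set Ss = Pow {1..k}" "distinct Ss"
    using finite_distinct_list[of "Pow {1..k}"] by auto
  have len: "length Ss = 4 * M"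
  proof -
    obtain k' where "k = 2 + k'" using k le_Suc_ex by blast
    then show ?thesis
      using distinct_card[OF Ss(2)] by (simp add: Ss(1) card_Pow M_def)
  qed
  define z where "z u v S \<sigma> t = of_bool (filled n u S \<sigma> t) - (of_bool (filled n v S \<sigma> t) :: int)" for u v S \<sigma> t
  define idx where "idx = index_list q Ss (4 ^ n)"
  define D where "D u v = map (\<lambda>i. of_int (signed (z u v) i) * (1 / real q)) idx" for u v
  define coord where "coord u i = real_of_int (signed (\<lambda>S \<sigma> t. of_bool (filled n u S \<sigma> t)) i) * (1 / real q)" for u i
  have D_coord: "D u v = map (\<lambda>i. coord u i - coord v i) idx" for u v
    unfolding D_def coord_def
    by (intro map_cong refl) (auto simp: signed_def z_def case_prod_unfold diff_divide_distrib algebra_simps)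
  let ?W = "pverts (laakso n k)"
  define \<D> where "\<D> = (\<lambda>(u, v). (D u v, 0 :: 'y)) ` (?W \<times> ?W)"
  have "finite \<D>" "\<eta> * N > 0"
    using finite_pverts_laakso \<eta>(1) N(1) by (simp_all add: \<D>_def)
  moreover have "length as = length idx" if "(as, u) \<in> \<D>" for as u
    using that by (auto simp: \<D>_def D_def)
  ultimately obtain ys where ys: "length ys = length idx"
    "\<forall>(as, u)\<in>\<D>. \<bar>norm (u + (\<Sum>(a, y)\<leftarrow>zip as ys. a *\<^sub>R y)) - iter_norm as u\<bar> < \<eta> * N"
    using ex_realization by blast
  define f where "f u = (\<Sum>(a, y)\<leftarrow>zip (map (coord u) idx) ys. a *\<^sub>R y)" for u
  have real: "\<bar>norm (f u - f v) - iter_norm (D u v) 0\<bar> < \<eta> * N" if "u \<in> ?W" "v \<in> ?W" for u v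
  proof -
    have "(D u v, 0) \<in> \<D>" unfolding \<D>_def by (rule image_eqI[of _ _ "(u, v)"]) (use that in auto)
    from bspec[OF ys(2) this] show ?thesis
      by (simp add: f_def sum_list_zip_diff D_coord)
  qed
  have upper: "norm (f u - f v) \<le> 4 * (1 + \<eta>)\<^sup>2 * N" if uv: "(u, v) \<in> parcs (laakso n k)" for u v
  proof -
    obtain w where w: "edge_label n n w u v"
      using edge_label_expand[OF _ edge_label_Source_Sink, of k n n u v] uv k by (auto simp: parcs_laakso)
    \<comment> \<open>The difference is taken from the start \<open>u\<close> of the arc to its end
      \<open>v\<close>, so that the newly filled cells have coefficient 1.\<close>
    have "iter_norm (D v u) 0 = alternating_norm q (4 * M)"
      unfolding D_def idx_def len[symmetric]
      using w by (intro iter_norm_profile_indicator[of _ w] q(1)) (auto simp: z_def edge_label_def)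
    also have "\<dots> \<le> 4 * ((1 + \<eta>) * N)"
      using alternating_norm_mult_le[of q 4 M] q(2) by simp
    finally have "norm (f v - f u) \<le> 4 * ((1 + \<eta>) * N) + \<eta> * N"
      using real[of v u] uv by (force simp: pverts_laakso endpoints_def)
    also have "\<dots> \<le> 4 * (1 + \<eta>)\<^sup>2 * N"
      using \<eta> N(1) by (simp add: power2_eq_square algebra_simps)
    finally show ?thesis by (simp add: norm_minus_commute)
  qed
  have lower: "\<exists>L. (u, v) \<in> walk_rel n k ^^ L \<and> (1 - \<eta>) * N / 2 * real L \<le> norm (f u - f v)"
    if uv: "u \<in> ?W" "v \<in> ?W" and sep: "separated n k (walk_rel n k) u v" for u v
  proof -
    obtain G \<alpha> L \<tau> \<delta> where G: "G \<subseteq> Pow {1..k}" "card G = M" and L: "(u, v) \<in> walk_rel n k ^^ L" "L \<le> 2 * \<alpha>"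
      and pre: "\<And>S. S \<in> G \<Longrightarrow> \<tau> S True \<le> 4 ^ n \<and> fill n u S True 0 (\<tau> S True) - fill n v S True 0 (\<tau> S True) = int \<alpha>"
      and suf: "\<And>S. S \<in> G \<Longrightarrow> \<tau> S False \<le> 4 ^ n \<and>
        fill n u S False (\<tau> S False) (4 ^ n) - fill n v S False (\<tau> S False) (4 ^ n) = int \<alpha>"
      and total: "\<And>S \<sigma>. fill n u S \<sigma> 0 (4 ^ n) - fill n v S \<sigma> 0 (4 ^ n) = \<delta>"
      using sep unfolding separated_def M_def by metis
    have sum_z: "(\<Sum>t=a..<b. z u v S \<sigma> t) = fill n u S \<sigma> a b - fill n v S \<sigma> a b" for S \<sigma> a b
      unfolding z_def fill_def by (rule sum_subtractf)
    show ?thesis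
    proof (cases "\<alpha> = 0")
      case True
      then show ?thesis using L by (intro exI[of _ L]) auto
    next
      case False
      have "real \<alpha> * N \<le> real \<alpha> * alternating_norm (\<alpha> * q) (card G)"
        using N(2)[of "\<alpha> * q"] False q(1) G(2) by (intro mult_left_mono) auto
      also have "\<dots> \<le> iter_norm (D u v) 0"
        unfolding D_def idx_def
        by (rule iter_norm_profile_ge[of Ss G "z u v" \<tau> "4 ^ n" \<alpha> \<delta> q])
          (use Ss G pre suf total False q(1) in \<open>auto simp: sum_z, auto simp: z_def\<close>)
      finally have "real \<alpha> * N - \<eta> * N \<le> norm (f u - f v)"
        using real[OF uv] by linarith
      \<comment> \<open>As \<open>\<alpha> \<ge> 1\<close>, the realization error is absorbed into
        the factor \<open>1 - \<eta>\<close>. For \<open>\<alpha> = 0\<close> this would fail, but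
        there \<open>L\<close> is 0.\<close>
      moreover have "\<eta> * N \<le> real \<alpha> * (\<eta> * N)"
        using False \<eta>(1) N(1) by simp
      moreover have "(1 - \<eta>) * N / 2 * real L \<le> (1 - \<eta>) * N / 2 * real (2 * \<alpha>)"
        using L(2) \<eta>(2) N(1) by (intro mult_left_mono of_nat_mono) auto
      moreover have "(1 - \<eta>) * N / 2 * real (2 * \<alpha>) = real \<alpha> * N - real \<alpha> * (\<eta> * N)"
        by (simp add: left_diff_distrib right_diff_distrib)
      ultimately have "(1 - \<eta>) * N / 2 * real L \<le> norm (f u - f v)"
        by linarith
      then show ?thesis using L(1) by blast
    qed
  qed
  have "\<exists>L. (u, v) \<in> walk_rel n k ^^ L \<and> (1 - \<eta>) * N / 2 * real L \<le> norm (f u - f v)"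
    if uv: "u \<in> ?W" "v \<in> ?W" for u v
  proof -
    have "expand k n (Source, Sink) \<subseteq> walk_rel n k"
      by (auto simp: walk_rel_def parcs_laakso)
    then have "separated n k (walk_rel n k) u v \<or> separated n k (walk_rel n k) v u"
      using separated_or[OF _ edge_label_Source_Sink, of k n n] k uv sym_walk_rel
      by (auto simp: pverts_laakso parcs_laakso)
    then show ?thesis
      using lower[OF uv] lower[OF uv(2,1)] relpow_sym[OF sym_walk_rel] by (metis norm_minus_commute)
  qed
  moreover have "range f \<subseteq> span (set ys)"
    by (auto simp: f_def sum_list_zip_in_span)
  ultimately show ?thesis
    using N(1) upper by (intro exI[of _ N] conjI exI[of _ "set ys"] exI[of _ f]) auto
qed

theorem theorem5p2:
  fixes \<epsilon> :: real and n k :: nat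
  assumes "\<epsilon> > 0"
    and "finitely_representable TYPE('y::banach) TYPE('x::banach)"
    and "\<not> reflexive_space TYPE('y)"
    and "n \<ge> 1" and "k \<ge> 2"
  shows "\<exists>f :: laakso_vertex \<Rightarrow> 'x.
           bilipschitz_embedding_distortion_le
             (pverts (laakso n k)) (laakso_dist n k) f (8 + \<epsilon>)"
proof -
  \<comment> \<open>Since \<open>(1 + \<eta>) ^ 3 \<le> 1 + 7 * \<eta>\<close>, the required
    inequality reduces to \<open>(64 + \<epsilon>) * \<eta> \<le> \<epsilon>\<close>, which holds
    with equality.\<close>
  define \<eta> where "\<eta> = \<epsilon> / (64 + \<epsilon>)"
  have \<eta>: "0 < \<eta>" "\<eta> < 1" "8 * (1 + \<eta>) ^ 3 \<le> (8 + \<epsilon>) * (1 - \<eta>)"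
  proof -
    show "0 < \<eta>" "\<eta> < 1" using assms(1) by (auto simp: \<eta>_def)
    then have "\<eta> * \<eta> \<le> \<eta>" "\<eta> * \<eta> * \<eta> \<le> \<eta>"
      by (auto simp: mult_le_one mult_left_le)
    then have "(1 + \<eta>) ^ 3 \<le> 1 + 7 * \<eta>"
      by (simp add: power3_eq_cube algebra_simps)
    moreover have "(64 + \<epsilon>) * \<eta> = \<epsilon>" using assms(1) by (simp add: \<eta>_def)
    ultimately show "8 * (1 + \<eta>) ^ 3 \<le> (8 + \<epsilon>) * (1 - \<eta>)"
      by (simp add: algebra_simps)
  qed
  obtain U :: "'y filter" and K F where "bidual_ultrafilter U K F"
    using ex_bidual_ultrafilter[OF assms(3)] by blast
  then interpret bidual_ultrafilter U K F .
  obtain N B and f :: "laakso_vertex \<Rightarrow> 'y" where N: "N > 0" and B: "finite B" "range f \<subseteq> span B"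
    and upper: "\<forall>(u, v)\<in>parcs (laakso n k). norm (f u - f v) \<le> 4 * (1 + \<eta>)\<^sup>2 * N"
    and lower: "\<forall>u\<in>pverts (laakso n k). \<forall>v\<in>pverts (laakso n k).
       \<exists>L. (u, v) \<in> walk_rel n k ^^ L \<and> (1 - \<eta>) * N / 2 * real L \<le> norm (f u - f v)"
    using ex_laakso_map[OF \<eta>(1,2) assms(5)] by metis
  obtain T :: "'y \<Rightarrow> 'x" where "linear T" and
    T: "\<And>y. y \<in> span B \<Longrightarrow> norm y \<le> norm (T y) \<and> norm (T y) \<le> (1 + \<eta>) * norm y"
    using assms(2)[unfolded finitely_representable_def, rule_format, of "span B" \<eta>] B(1) \<eta>(1) by auto
  have Tf: "norm (f u - f v) \<le> norm (T (f u) - T (f v))"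
    "norm (T (f u) - T (f v)) \<le> (1 + \<eta>) * norm (f u - f v)" for u v
    using T[of "f u - f v"] B(2) by (auto simp: linear_diff[OF \<open>linear T\<close>] span_diff image_subset_iff)
  \<comment> \<open>Bounds the image of an edge. The three factors \<open>1 + \<eta>\<close> come
    from the near-optimal \<open>q\<close>, the realization by vectors and the map
    \<open>T\<close>.\<close>
  define C where "C = 4 * (1 + \<eta>) ^ 3 * N"
  have C: "C > 0" using N \<eta>(1) by (simp add: C_def)
  have "norm (T (f u) - T (f v)) \<le> C" if "(u, v) \<in> walk_rel n k" for u v
  proof -
    have "norm (f u - f v) \<le> 4 * (1 + \<eta>)\<^sup>2 * N"
      using that upper by (auto simp: walk_rel_def norm_minus_commute)
    then have "(1 + \<eta>) * norm (f u - f v) \<le> (1 + \<eta>) * (4 * (1 + \<eta>)\<^sup>2 * N)"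
      using \<eta>(1) by (intro mult_left_mono) auto
    also have "\<dots> = C" by (simp add: C_def power2_eq_square power3_eq_cube)
    finally show ?thesis using Tf(2)[of u v] by linarith
  qed
  then have walk_le: "norm (T (f u) - T (f v)) \<le> real l * C" if "(u, v) \<in> walk_rel n k ^^ l" for u v l
    using relpow_norm_le[of "walk_rel n k" "\<lambda>u. T (f u)" C] that by blast
  \<comment> \<open>The factor \<open>4 ^ n\<close> converts distances into numbers of
    edges.\<close>
  define r where "r = 4 ^ n * ((1 - \<eta>) * N / 2)"
  have "r > 0" using N \<eta>(2) by (simp add: r_def)
  moreover have "r * laakso_dist n k u v \<le> norm (T (f u) - T (f v)) \<and>
      norm (T (f u) - T (f v)) \<le> (8 + \<epsilon>) * r * laakso_dist n k u v"
    if uv: "u \<in> pverts (laakso n k)" "v \<in> pverts (laakso n k)" for u v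
  proof -
    obtain L where L: "(u, v) \<in> walk_rel n k ^^ L" "(1 - \<eta>) * N / 2 * real L \<le> norm (f u - f v)"
      using lower uv by blast
    \<comment> \<open>Each edge moves the image by at most \<open>C\<close>, so every walk from
      \<open>u\<close> to \<open>v\<close> has at least this many edges; this bounds the distance
      from below.\<close>
    have "norm (T (f u) - T (f v)) / C \<le> real l" if "(u, v) \<in> walk_rel n k ^^ l" for l
      using walk_le[OF that] C by (simp add: field_simps)
    note dist = laakso_dist_bounds[OF L(1) uv(1) this]
    have "r * laakso_dist n k u v \<le> r * (real L / 4 ^ n)"
      using dist(1) \<open>r > 0\<close> by (intro mult_left_mono) auto
    also have "\<dots> = (1 - \<eta>) * N / 2 * real L" by (simp add: r_def)
    also have "\<dots> \<le> norm (T (f u) - T (f v))"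
      using L(2) Tf(1)[of u v] by linarith
    finally have low: "r * laakso_dist n k u v \<le> norm (T (f u) - T (f v))" .
    have nonneg: "0 \<le> laakso_dist n k u v"
    proof -
      have "0 \<le> norm (T (f u) - T (f v)) / C / 4 ^ n" using C by simp
      then show ?thesis using dist(2) by linarith
    qed
    have "norm (T (f u) - T (f v)) \<le> C * 4 ^ n * laakso_dist n k u v"
      using dist(2) C by (simp add: field_simps)
    also have "C * 4 ^ n \<le> (8 + \<epsilon>) * r"
    proof -
      have "8 * (1 + \<eta>) ^ 3 * (N / 2 * 4 ^ n) \<le> (8 + \<epsilon>) * (1 - \<eta>) * (N / 2 * 4 ^ n)"
        using N by (intro mult_right_mono \<eta>(3)) auto
      then show ?thesis by (simp add: C_def r_def mult_ac)
    qed
    then have "C * 4 ^ n * laakso_dist n k u v \<le> (8 + \<epsilon>) * r * laakso_dist n k u v"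
      using nonneg by (rule mult_right_mono)
    finally show ?thesis using low by simp
  qed
  ultimately show ?thesis
    unfolding bilipschitz_embedding_distortion_le_def by (intro exI[of _ "\<lambda>u. T (f u)"] exI[of _ r]) auto
qed

end
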